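(* Let $\mathcal H,\mathcal K$ be Hilbert spaces, $A$ a possibly unbounded densely defined closed operator in $\mathcal H$, $C$ a (possibly unbounded) self-adjoint operator in $\mathcal K$ with spectral measure $E_C$, and $Y\in\mathcal B(\mathcal H,\mathcal K)$. Suppose $$\operatorname{dist}\{\operatorname{spec}(A),\operatorname{spec}(C)\}>0 .$$ Then the following hold. (i) If the Sylvester equation $XA-CX=Y$ has a strong solution $X\in\mathcal B(\mathcal H,\mathcal K)$, then $X$ is the unique strong solution, and it is represented by the Stieltjes integral $$X=\int_{\operatorname{spec}(C)}E_C(d\mu)\,Y(A-\mu)^{-1},$$ which converges in the strong operator topology of $\mathcal B(\mathcal H,\mathcal K)$. Conversely, if this Stieltjes integral converges in the strong operator topology, then $X$ given by it is a strong solution of $XA-CX=Y$. (ii) If the dual Sylvester equation $ZC-A^*Z=Y^*$ has a strong solution $Z\in\mathcal B(\mathcal K,\mathcal H)$, then $Z$ is the unique strong solution, and it is represented by the Stieltjes integral $$Z=-\int_{\operatorname{spec}(C)}(A^*-\mu)^{-1}Y^*E_C(d\mu),$$ which converges in the strong operator topology of $\mathcal B(\mathcal K,\mathcal H)$. Conversely, if this Stieltjes integral converges in the strong operator topology, then $Z$ given by it is a strong solution of $ZC-A^*Z=Y^*$.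
   Context: $\mathcal B(\mathcal H,\mathcal K)$ is the space of bounded operators from $\mathcal H$ to $\mathcal K$. Strong solutions: for closed densely defined $A$ in $\mathcal H$, $C$ in $\mathcal K$, $X\in\mathcal B(\mathcal H,\mathcal K)$ is a strong solution of $XA-CX=Y$ if $X(\operatorname{dom}(A))\subset\operatorname{dom}(C)$ and $XAf-CXf=Yf$ for all $f\in\operatorname{dom}(A)$. For $C$ self-adjoint, $Z\in\mathcal B(\mathcal K,\mathcal H)$ is a strong solution of $ZC-A^*Z=Y^*$ if $Z(\operatorname{dom}(C))\subset\operatorname{dom}(A^* )$ and $ZCf-A^*Zf=Y^*f$ for all $f\in\operatorname{dom}(C)$. Stieltjes integrals: for $G:\operatorname{spec}(C)\to\mathcal B(\mathcal H,\mathcal K)$ and a finite interval $[a,b)$, $\int_{[a,b)\cap\operatorname{spec}(C)}E_C(d\mu)G(\mu)$ is the limit, as $\max_k|\delta_k|\to0$, of the sums $\sum_k E_C(\delta_k)G(\zeta_k)$ over partitions of $[a,b)$ into intervals $\delta_k=[\mu_{k-1},\mu_k)$, where the sum is over those $k$ with $\delta_k\cap\operatorname{spec}(C)\neq\emptyset$ and $\zeta_k\in\delta_k\cap\operatorname{spec}(C)$. The integral $\int_{\operatorname{spec}(C)}E_C(d\mu)G(\mu)$ is the limit of these as $a\to-\infty$, $b\to+\infty$. Convergence in the uniform (strong, weak) operator topology means that the limits exist in that topology. Integrals $\int F(\mu)E_C(d\mu)$ with $F:\operatorname{spec}(C)\to\mathcal B(\mathcal K,\mathcal H)$ are defined analogously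 with sums $\sum_kF(\zeta_k)E_C(\delta_k)$. *)

theory Defs
  imports "HOL-Analysis.Analysis"
begin

section \<open>Complex Hilbert spaces\<close>

text \<open>
  The class refines a complete real inner product space, so that norm, topology and bounded
  operators are the library's: the real inner product is the real part of the complex one,
  hence \<open>norm x = sqrt (Re (cinner x x))\<close>.  \<open>cinner\<close> is conjugate-linear in its first argument.
\<close>

class complex_hilbert_space = real_inner + complete_space +
  fixes scaleC :: "complex \<Rightarrow> 'a \<Rightarrow> 'a" (infixr "*\<^sub>C" 75)
    and cinner :: "'a \<Rightarrow> 'a \<Rightarrow> complex"
  assumes scaleC_add_right: "c *\<^sub>C (x + y) = c *\<^sub>C x + c *\<^sub>C y"
    and scaleC_add_left: "(c + d) *\<^sub>C x = c *\<^sub>C x + d *\<^sub>C x"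
    and scaleC_scaleC: "c *\<^sub>C (d *\<^sub>C x) = (c * d) *\<^sub>C x"
    and scaleC_of_real: "complex_of_real r *\<^sub>C x = r *\<^sub>R x"
    and cinner_commute: "cinner x y = cnj (cinner y x)"
    and cinner_add_right: "cinner x (y + z) = cinner x y + cinner x z"
    and cinner_scaleC_right: "cinner x (c *\<^sub>C y) = c * cinner x y"
    and inner_eq_Re_cinner: "inner x y = Re (cinner x y)"


section \<open>Bounded operators\<close>

text \<open>
  The library type \<open>'a \<Rightarrow>\<^sub>L 'b\<close> consists of the bounded \<^emph>\<open>real\<close>-linear maps; \<open>bounded_ops\<close> is
  the space of bounded complex-linear operators, and \<open>sot\<close> its strong operator topology.
\<close>

definition bounded_ops ::
    "('a::complex_hilbert_space \<Rightarrow>\<^sub>L 'b::complex_hilbert_space) set" where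
  "bounded_ops = {T. \<forall>c x. blinfun_apply T (c *\<^sub>C x) = c *\<^sub>C blinfun_apply T x}"

definition sot ::
    "('a::complex_hilbert_space \<Rightarrow>\<^sub>L 'b::complex_hilbert_space) topology" where
  "sot = subtopology strong_operator_topology bounded_ops"

definition bounded_adjoint ::
    "('a::complex_hilbert_space \<Rightarrow>\<^sub>L 'b::complex_hilbert_space) \<Rightarrow> ('b \<Rightarrow>\<^sub>L 'a)" where
  "bounded_adjoint T =
     (THE S. \<forall>x y. cinner (blinfun_apply T x) y = cinner x (blinfun_apply S y))"

definition orthogonal_projection :: "('a::complex_hilbert_space \<Rightarrow>\<^sub>L 'a) \<Rightarrow> bool" where
  "orthogonal_projection P \<longleftrightarrow> P \<in> bounded_ops \<and> P o\<^sub>L P = P \<and>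
     (\<forall>x y. cinner (blinfun_apply P x) y = cinner x (blinfun_apply P y))"


section \<open>Unbounded operators\<close>

text \<open>A possibly unbounded operator is identified with its graph.\<close>

definition linear_operator :: "('a::complex_hilbert_space \<times> 'a) set \<Rightarrow> bool" where
  "linear_operator T \<longleftrightarrow> single_valued T \<and> (0, 0) \<in> T \<and>
     (\<forall>x y u v. (x, u) \<in> T \<longrightarrow> (y, v) \<in> T \<longrightarrow> (x + y, u + v) \<in> T) \<and>
     (\<forall>c x u. (x, u) \<in> T \<longrightarrow> (c *\<^sub>C x, c *\<^sub>C u) \<in> T)"

definition op_dom :: "('a \<times> 'a) set \<Rightarrow> 'a set" where
  "op_dom T = Domain T"

definition op_app :: "('a \<times> 'a) set \<Rightarrow> 'a \<Rightarrow> 'a" where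
  "op_app T x = (THE y. (x, y) \<in> T)"

definition densely_defined :: "('a::complex_hilbert_space \<times> 'a) set \<Rightarrow> bool" where
  "densely_defined T \<longleftrightarrow> closure (op_dom T) = UNIV"

definition closed_operator :: "('a::complex_hilbert_space \<times> 'a) set \<Rightarrow> bool" where
  "closed_operator T \<longleftrightarrow> linear_operator T \<and> closed T"

definition adjoint_op ::
    "('a::complex_hilbert_space \<times> 'a) set \<Rightarrow> ('a \<times> 'a) set" where
  "adjoint_op T = {(y, z). \<forall>x\<in>op_dom T. cinner (op_app T x) y = cinner x z}"

definition self_adjoint :: "('a::complex_hilbert_space \<times> 'a) set \<Rightarrow> bool" where
  "self_adjoint T \<longleftrightarrow> linear_operator T \<and> densely_defined T \<and> adjoint_op T = T"

definition shifted_inverse ::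
    "('a::complex_hilbert_space \<times> 'a) set \<Rightarrow> complex \<Rightarrow> 'a \<Rightarrow> 'a" where
  "shifted_inverse T l = inv_into (op_dom T) (\<lambda>x. op_app T x - l *\<^sub>C x)"

definition resolvent_set :: "('a::complex_hilbert_space \<times> 'a) set \<Rightarrow> complex set" where
  "resolvent_set T =
     {l. bij_betw (\<lambda>x. op_app T x - l *\<^sub>C x) (op_dom T) UNIV \<and> bounded_linear (shifted_inverse T l)}"

definition spec :: "('a::complex_hilbert_space \<times> 'a) set \<Rightarrow> complex set" where
  "spec T = - resolvent_set T"

definition resolvent ::
    "('a::complex_hilbert_space \<times> 'a) set \<Rightarrow> complex \<Rightarrow> ('a \<Rightarrow>\<^sub>L 'a)" where
  "resolvent T l = Blinfun (shifted_inverse T l)"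

text \<open>The spectrum of a self-adjoint operator as a subset of the real line.\<close>

definition real_spec :: "('a::complex_hilbert_space \<times> 'a) set \<Rightarrow> real set" where
  "real_spec T = {t. complex_of_real t \<in> spec T}"

text \<open>
  Extended-real valued, so that the distance to an empty set is \<open>\<infinity>\<close>; the library's \<open>setdist\<close>
  would return \<open>0\<close>, although the spectrum of an unbounded closed operator may be empty.
\<close>

definition set_dist :: "complex set \<Rightarrow> complex set \<Rightarrow> ereal" where
  "set_dist S T = (INF s\<in>S. INF t\<in>T. ereal (dist s t))"


section \<open>Spectral measures\<close>

definition projection_valued_measure ::
    "(real set \<Rightarrow> ('a::complex_hilbert_space \<Rightarrow>\<^sub>L 'a)) \<Rightarrow> bool" where
  "projection_valued_measure E \<longleftrightarrow>
     (\<forall>B\<in>sets borel. orthogonal_projection (E B)) \<and>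
     E UNIV = id_blinfun \<and>
     (\<forall>F::nat \<Rightarrow> real set. range F \<subseteq> sets borel \<longrightarrow> disjoint_family F \<longrightarrow>
        (\<forall>x. (\<lambda>n. blinfun_apply (E (F n)) x) sums blinfun_apply (E (\<Union>n. F n)) x))"

definition scalar_measure ::
    "(real set \<Rightarrow> ('a::complex_hilbert_space \<Rightarrow>\<^sub>L 'a)) \<Rightarrow> 'a \<Rightarrow> real measure" where
  "scalar_measure E x =
     measure_of UNIV (sets borel) (\<lambda>B. ennreal (Re (cinner x (blinfun_apply (E B) x))))"

text \<open>
  \<open>T\<close> is the integral of \<open>t\<close> with respect to \<open>E\<close>.  The integral is read weakly; the quadratic
  form determines the operator by polarization.
\<close>

definition is_spectral_measure ::
    "('a::complex_hilbert_space \<times> 'a) set \<Rightarrow> (real set \<Rightarrow> ('a \<Rightarrow>\<^sub>L 'a)) \<Rightarrow> bool" where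
  "is_spectral_measure T E \<longleftrightarrow>
     projection_valued_measure E \<and>
     op_dom T = {x. integrable (scalar_measure E x) (\<lambda>t. t\<^sup>2)} \<and>
     (\<forall>x\<in>op_dom T. cinner x (op_app T x) = complex_of_real (\<integral>t. t \<partial>scalar_measure E x))"


section \<open>Stieltjes integrals\<close>

text \<open>
  A triple \<open>(n, m, z)\<close> encodes the partition \<open>a = m 0 < \<dots> < m n = b\<close> into the intervals
  \<open>{m (k - 1)..<m k}\<close>, \<open>1 \<le> k \<le> n\<close>, with a tag \<open>z k\<close> for each interval that meets \<open>S\<close>.  The
  values of \<open>z\<close> on the other intervals are irrelevant.
\<close>

type_synonym tagged_partition = "nat \<times> (nat \<Rightarrow> real) \<times> (nat \<Rightarrow> real)"

definition tagged_partitions :: "real set \<Rightarrow> real \<Rightarrow> real \<Rightarrow> tagged_partition set" where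
  "tagged_partitions S a b =
     {(n, m, z). m 0 = a \<and> m n = b \<and>
        (\<forall>k\<in>{1..n}. m (k - 1) < m k \<and>
           ({m (k - 1)..<m k} \<inter> S \<noteq> {} \<longrightarrow> z k \<in> {m (k - 1)..<m k} \<inter> S))}"

definition mesh_to_zero :: "real set \<Rightarrow> real \<Rightarrow> real \<Rightarrow> tagged_partition filter" where
  "mesh_to_zero S a b =
     (INF d\<in>{0<..}. principal {(n, m, z). (n, m, z) \<in> tagged_partitions S a b \<and>
                                 (\<forall>k\<in>{1..n}. m k - m (k - 1) < d)})"

text \<open>
  The summand \<open>h \<delta> \<zeta>\<close> is \<open>E \<delta> o\<^sub>L G \<zeta>\<close> for left and \<open>F \<zeta> o\<^sub>L E \<delta>\<close> for right integrals.
\<close>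

definition stieltjes_sum ::
    "real set \<Rightarrow> (real set \<Rightarrow> real \<Rightarrow> 'c::comm_monoid_add) \<Rightarrow> tagged_partition \<Rightarrow> 'c" where
  "stieltjes_sum S h = (\<lambda>(n, m, z).
     \<Sum>k | k \<in> {1..n} \<and> {m (k - 1)..<m k} \<inter> S \<noteq> {}. h {m (k - 1)..<m k} (z k))"

definition has_stieltjes_integral_on ::
    "'c::comm_monoid_add topology \<Rightarrow> real set \<Rightarrow> (real set \<Rightarrow> real \<Rightarrow> 'c) \<Rightarrow>
     real \<Rightarrow> real \<Rightarrow> 'c \<Rightarrow> bool" where
  "has_stieltjes_integral_on \<T> S h a b J \<longleftrightarrow>
     limitin \<T> (stieltjes_sum S h) J (mesh_to_zero S a b)"

definition has_stieltjes_integral ::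
    "'c::comm_monoid_add topology \<Rightarrow> real set \<Rightarrow> (real set \<Rightarrow> real \<Rightarrow> 'c) \<Rightarrow> 'c \<Rightarrow> bool" where
  "has_stieltjes_integral \<T> S h I \<longleftrightarrow>
     (\<exists>J. (\<forall>a b. a < b \<longrightarrow> has_stieltjes_integral_on \<T> S h a b (J a b)) \<and>
          limitin \<T> (\<lambda>(a, b). J a b) I (at_bot \<times>\<^sub>F at_top))"

definition has_left_integral ::
    "('k::complex_hilbert_space \<times> 'k) set \<Rightarrow> (real set \<Rightarrow> ('k \<Rightarrow>\<^sub>L 'k)) \<Rightarrow>
     (real \<Rightarrow> ('h::complex_hilbert_space \<Rightarrow>\<^sub>L 'k)) \<Rightarrow> ('h \<Rightarrow>\<^sub>L 'k) \<Rightarrow> bool" where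
  "has_left_integral C E G I \<longleftrightarrow>
     has_stieltjes_integral sot (real_spec C) (\<lambda>\<delta> \<zeta>. E \<delta> o\<^sub>L G \<zeta>) I"

definition has_right_integral ::
    "('k::complex_hilbert_space \<times> 'k) set \<Rightarrow> (real set \<Rightarrow> ('k \<Rightarrow>\<^sub>L 'k)) \<Rightarrow>
     (real \<Rightarrow> ('k \<Rightarrow>\<^sub>L 'h::complex_hilbert_space)) \<Rightarrow> ('k \<Rightarrow>\<^sub>L 'h) \<Rightarrow> bool" where
  "has_right_integral C E F I \<longleftrightarrow>
     has_stieltjes_integral sot (real_spec C) (\<lambda>\<delta> \<zeta>. F \<zeta> o\<^sub>L E \<delta>) I"


section \<open>Sylvester equations\<close>

text \<open>
  \<open>strong_solution A C Y X\<close>: \<open>X\<close> is a strong solution of \<open>XA - CX = Y\<close>.  The dual equation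
  \<open>ZC - A\<^sup>*Z = Y\<^sup>*\<close> has the same form with \<open>(C, A\<^sup>*, Y\<^sup>*)\<close> in place of \<open>(A, C, Y)\<close>.
\<close>

definition strong_solution ::
    "('h::complex_hilbert_space \<times> 'h) set \<Rightarrow> ('k::complex_hilbert_space \<times> 'k) set \<Rightarrow>
     ('h \<Rightarrow>\<^sub>L 'k) \<Rightarrow> ('h \<Rightarrow>\<^sub>L 'k) \<Rightarrow> bool" where
  "strong_solution A C Y X \<longleftrightarrow>
     X \<in> bounded_ops \<and>
     blinfun_apply X ` op_dom A \<subseteq> op_dom C \<and>
     (\<forall>f\<in>op_dom A. blinfun_apply X (op_app A f) - op_app C (blinfun_apply X f) = blinfun_apply Y f)"

definition dual_strong_solution ::
    "('h::complex_hilbert_space \<times> 'h) set \<Rightarrow> ('k::complex_hilbert_space \<times> 'k) set \<Rightarrow>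
     ('h \<Rightarrow>\<^sub>L 'k) \<Rightarrow> ('k \<Rightarrow>\<^sub>L 'h) \<Rightarrow> bool" where
  "dual_strong_solution A C Y Z \<longleftrightarrow>
     strong_solution C (adjoint_op A) (bounded_adjoint Y) Z"

end

theory Submission
  imports Defs
begin

text \<open>
  For a strong solution \<open>X\<close>, applying the equation to \<open>(A - \<zeta>)\<^sup>-\<^sup>1 f\<close> shows
  \<open>E \<delta> Y (A - \<zeta>)\<^sup>-\<^sup>1 = E \<delta> X - (C - \<zeta>) E \<delta> X (A - \<zeta>)\<^sup>-\<^sup>1\<close>.  On the range of \<open>E \<delta>\<close> the norm of
  \<open>C - \<zeta>\<close> is at most \<open>\<bar>\<delta>\<bar>\<close>, and the ranges for different \<open>\<delta>\<close> are orthogonal, so the error in a sum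
  over \<open>[a, b)\<close> is of order \<open>(\<Sum> \<bar>\<delta>\<bar>\<^sup>2)\<^sup>1\<^sup>/\<^sup>2\<close>, because the resolvent of \<open>A\<close> is bounded near the part of the
  spectrum of \<open>C\<close> in \<open>[a, b)\<close>.  Hence the integral over \<open>[a, b)\<close> is \<open>E [a, b) X\<close>, which tends to \<open>X\<close>;
  this also gives uniqueness.  Conversely, the sums solve the equation up to the same kind of error,
  and the limit does so because the graph of \<open>C\<close> is closed.  The dual equation is treated in the
  same way with \<open>A\<^sup>*\<close>, using the Cauchy--Schwarz inequality instead of orthogonality.
\<close>

section \<open>Complex Hilbert spaces\<close>

text \<open>The spectral measure is tied to \<open>C\<close> only through the domain and the
  quadratic form, so three facts must be extracted from the form: \<open>E B\<close> commutes with
  \<open>C\<close>; for bounded \<open>B\<close> within distance \<open>c\<close> of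
  \<open>r\<close>, the norm of \<open>C - r\<close> on the range of \<open>E B\<close> is at most
  \<open>c\<close>; and \<open>E B\<close> vanishes when \<open>B\<close> misses the spectrum. The
  last fact is why sums that skip the intervals without spectrum still add up to the projection of
  the whole window \<open>[a, b)\<close>. The resolvent is bounded one window at a time. The
  positive distance keeps even the closure of the part of the spectrum of \<open>C\<close> in
  \<open>[a, b)\<close> inside the resolvent set of \<open>A\<close>, and compactness gives a bound.
  This bound may grow with the window, because the mesh tends to zero before \<open>a\<close> and
  \<open>b\<close> move. Both equations run through one locale with an operator \<open>T\<close>,
  namely \<open>A\<close> or \<open>adjoint_op A\<close>. The tags are real, so conjugation fixes
  them and the adjoint has the same resolvent points there.\<close>

lemma scaleC_zero_left [simp]: "0 *\<^sub>C x = (0 :: 'a::complex_hilbert_space)"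
  using scaleC_of_real[of 0 x] by simp

lemma scaleC_zero_right [simp]: "c *\<^sub>C 0 = (0 :: 'a::complex_hilbert_space)"
  using scaleC_add_right[of c 0 0] by simp

lemma scaleC_minus_one: "(-1) *\<^sub>C x = - (x :: 'a::complex_hilbert_space)"
  using scaleC_of_real[of "-1" x] by simp

lemma scaleC_minus_right: "c *\<^sub>C (- x) = - (c *\<^sub>C (x :: 'a::complex_hilbert_space))"
  using scaleC_add_right[of c x "- x"] by (simp add: eq_neg_iff_add_eq_0 add.commute)

lemma scaleC_minus_left: "(- c) *\<^sub>C x = - (c *\<^sub>C (x :: 'a::complex_hilbert_space))"
  using scaleC_add_left[of c "- c" x] by (simp add: eq_neg_iff_add_eq_0 add.commute)

lemma scaleC_diff_right: "c *\<^sub>C (x - y) = c *\<^sub>C x - c *\<^sub>C (y :: 'a::complex_hilbert_space)"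
  using scaleC_add_right[of c x "- y"] by (simp add: scaleC_minus_right)

lemma scaleC_diff_left: "(c - d) *\<^sub>C x = c *\<^sub>C x - d *\<^sub>C (x :: 'a::complex_hilbert_space)"
  using scaleC_add_left[of c "- d" x] by (simp add: scaleC_minus_left)

lemma cinner_zero_right [simp]: "cinner (x :: 'a::complex_hilbert_space) 0 = 0"
  using cinner_add_right[of x 0 0] by simp

lemma cinner_scaleC_left: "cinner (c *\<^sub>C x) (y :: 'a::complex_hilbert_space) = cnj c * cinner x y"
  by (metis cinner_commute cinner_scaleC_right complex_cnj_mult)

lemma cinner_add_left: "cinner (x + y) (z :: 'a::complex_hilbert_space) = cinner x z + cinner y z"
  by (metis cinner_commute cinner_add_right complex_cnj_add)

lemma cinner_minus_right: "cinner x (- y :: 'a::complex_hilbert_space) = - cinner x y"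
  using cinner_scaleC_right[of x "-1" y] by (simp add: scaleC_minus_one)

lemma cinner_minus_left: "cinner (- x) (y :: 'a::complex_hilbert_space) = - cinner x y"
  using cinner_scaleC_left[of "-1" x y] by (simp add: scaleC_minus_one)

lemma cinner_diff_right: "cinner x (y - z :: 'a::complex_hilbert_space) = cinner x y - cinner x z"
  using cinner_add_right[of x y "- z"] by (simp add: cinner_minus_right)

lemma cinner_diff_left: "cinner (x - y) (z :: 'a::complex_hilbert_space) = cinner x z - cinner y z"
  using cinner_add_left[of x "- y" z] by (simp add: cinner_minus_left)

lemma cinner_self: "cinner x x = complex_of_real ((norm (x :: 'a::complex_hilbert_space))\<^sup>2)"
proof (rule complex_eqI)
  show "Re (cinner x x) = Re (complex_of_real ((norm x)\<^sup>2))"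
    by (simp add: power2_norm_eq_inner inner_eq_Re_cinner del: of_real_power)
  show "Im (cinner x x) = Im (complex_of_real ((norm x)\<^sup>2))"
    using arg_cong[OF cinner_commute[of x x], of Im] by (simp del: of_real_power)
qed

text \<open>Multiplying by \<open>- \<i>\<close> turns an imaginary part into a real part.
  Continuity and vanishing of \<open>cinner\<close> can therefore be reduced to the real inner
  product.\<close>

lemma cinner_conv_inner:
  "cinner x (y :: 'a::complex_hilbert_space) = Complex (inner x y) (inner x ((- \<i>) *\<^sub>C y))"
  by (simp add: inner_eq_Re_cinner cinner_scaleC_right)

lemma inner_eqI:
  assumes "\<And>z. inner x z = inner y (z :: 'a::complex_hilbert_space)"
  shows "x = y"
  using assms vector_eq_rdot by blast

lemma cinner_eqI:
  assumes "\<And>z. cinner z x = cinner z (y :: 'a::complex_hilbert_space)"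
  shows "x = y"
  by (rule inner_eqI) (metis assms inner_commute inner_eq_Re_cinner)

lemma norm_scaleC: "norm (c *\<^sub>C (x :: 'a::complex_hilbert_space)) = cmod c * norm x"
proof -
  have "complex_of_real ((norm (c *\<^sub>C x))\<^sup>2) = c * cnj c * complex_of_real ((norm x)\<^sup>2)"
    unfolding cinner_self[symmetric] by (simp add: cinner_scaleC_left cinner_scaleC_right)
  also have "\<dots> = complex_of_real ((cmod c * norm x)\<^sup>2)"
    by (simp only: complex_norm_square[symmetric] of_real_mult[symmetric] power_mult_distrib)
  finally have "(norm (c *\<^sub>C x))\<^sup>2 = (cmod c * norm x)\<^sup>2"
    using of_real_eq_iff by blast
  then show ?thesis
    by (simp add: power2_eq_iff_nonneg)
qed

lemma scaleR_scaleC: "r *\<^sub>R (c *\<^sub>C x) = c *\<^sub>C (r *\<^sub>R (x :: 'a::complex_hilbert_space))"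
  by (metis scaleC_of_real scaleC_scaleC mult.commute)

lemma bounded_linear_scaleC: "bounded_linear ((*\<^sub>C) c :: 'a::complex_hilbert_space \<Rightarrow> 'a)"
  by (rule bounded_linear_intro[of _ "cmod c"])
    (simp_all add: scaleC_add_right norm_scaleC scaleR_scaleC mult.commute)

lemma tendsto_scaleC:
  "(f \<longlongrightarrow> l) F \<Longrightarrow> ((\<lambda>x. c *\<^sub>C f x) \<longlongrightarrow> c *\<^sub>C (l :: 'a::complex_hilbert_space)) F"
  by (rule bounded_linear.tendsto[OF bounded_linear_scaleC])

lemma continuous_on_cinner_right:
  "continuous_on UNIV (\<lambda>y. cinner x (y :: 'a::complex_hilbert_space))"
  unfolding cinner_conv_inner continuous_on_def
  by (intro ballI tendsto_intros tendsto_Complex tendsto_scaleC)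

text \<open>The vectors orthogonal to \<open>x\<close> form a closed set, so density puts
  \<open>x\<close> itself among them.\<close>

lemma cinner_eq_zero_dense:
  assumes "closure D = UNIV" "\<And>y. y \<in> D \<Longrightarrow> cinner y x = 0"
  shows "x = (0 :: 'a::complex_hilbert_space)"
proof -
  have "closed {y. cinner x y = 0}"
    by (rule closed_Collect_eq) (auto intro: continuous_on_cinner_right)
  moreover have "D \<subseteq> {y. cinner x y = 0}"
    using assms(2) by (auto intro: cinner_commute[THEN trans])
  ultimately have "closure D \<subseteq> {y. cinner x y = 0}"
    by (rule closure_minimal[rotated])
  then have "cinner x x = 0"
    using assms(1) by blast
  then show ?thesis
    by (simp add: cinner_self)
qed


section \<open>Bounded operators and their adjoints\<close>

text \<open>A minimizing sequence of \<open>\<parallel>x\<parallel>\<^sup>2 - 2 f x\<close> is Cauchy by the parallelogram law.\<close>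

lemma riesz_representation:
  fixes f :: "'a::{real_inner, complete_space} \<Rightarrow> real"
  assumes "bounded_linear f"
  obtains z where "\<And>x. f x = inner x z"
proof -
  interpret f: bounded_linear f by fact
  obtain B where B: "\<And>x. norm (f x) \<le> norm x * B"
    using f.bounded by blast
  define g where "g x = (norm x)\<^sup>2 - 2 * f x" for x
  have g_ge: "g x \<ge> - B\<^sup>2" for x
  proof -
    have "2 * f x \<le> 2 * (norm x * B)"
      using B[of x] by simp
    also have "\<dots> \<le> (norm x)\<^sup>2 + B\<^sup>2"
      using sum_squares_bound[of "norm x" B] by simp
    finally show ?thesis by (simp add: g_def)
  qed
  define d where "d = Inf (range g)"
  have bdd: "bdd_below (range g)"
    using g_ge by (meson bdd_belowI2)
  have d_le: "d \<le> g x" for x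
    unfolding d_def by (rule cInf_lower[OF _ bdd]) auto
  have "\<exists>x. g x < d + 1 / real (Suc n)" for n
  proof -
    have "Inf (range g) < d + 1 / real (Suc n)"
      by (simp add: d_def)
    then show ?thesis
      using cInf_less_iff[OF _ bdd] by auto
  qed
  then obtain u where u: "\<And>n. g (u n) < d + 1 / real (Suc n)"
    by metis
  \<comment> \<open>The parallelogram identity brings in \<open>g\<close> at the midpoint, which is
    at least \<open>d\<close>.\<close>
  have par: "(norm (x - y))\<^sup>2 \<le> 2 * (g x - d) + 2 * (g y - d)" for x y
  proof -
    have "(norm (x - y))\<^sup>2 = 2 * g x + 2 * g y - 4 * g ((1/2) *\<^sub>R (x + y))"
      unfolding g_def power2_norm_eq_inner f.scaleR f.add
      by (simp add: inner_diff_left inner_diff_right inner_add_left inner_add_right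
          inner_commute algebra_simps)
    then show ?thesis
      using d_le[of "(1/2) *\<^sub>R (x + y)"] by argo
  qed
  have "Cauchy u"
  proof (rule metric_CauchyI)
    fix e :: real assume "e > 0"
    then obtain N where N: "1 / real (Suc N) < e\<^sup>2 / 4"
      using nat_approx_posE[of "e\<^sup>2 / 4"] by auto
    have "dist (u m) (u n) < e" if "m \<ge> N" "n \<ge> N" for m n
    proof -
      have small: "g (u k) - d < e\<^sup>2 / 4" if "k \<ge> N" for k
      proof -
        have "1 / real (Suc k) \<le> 1 / real (Suc N)"
          using that by (simp add: frac_le)
        then show ?thesis using u[of k] N by linarith
      qed
      have "(norm (u m - u n))\<^sup>2 < e\<^sup>2"
        using par[of "u m" "u n"] small[OF that(1)] small[OF that(2)] by argo
      then show ?thesis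
        using \<open>e > 0\<close> by (simp add: dist_norm power2_less_imp_less)
    qed
    then show "\<exists>N. \<forall>m\<ge>N. \<forall>n\<ge>N. dist (u m) (u n) < e" by blast
  qed
  then obtain z where z: "u \<longlonglongrightarrow> z"
    using Cauchy_convergent convergent_def by blast
  have "(\<lambda>n. g (u n)) \<longlonglongrightarrow> g z"
    unfolding g_def by (intro tendsto_intros z f.tendsto)
  moreover have "(\<lambda>n. d + 1 / real (Suc n)) \<longlonglongrightarrow> d + 0"
    by (intro tendsto_intros LIMSEQ_Suc[OF lim_1_over_n])
  ultimately have "g z \<le> d + 0"
    by (rule LIMSEQ_le) (use u less_imp_le in blast)
  then have min: "g z \<le> g x" for x
    using d_le[of x] by simp
  have "f x = inner x z" for x
  proof (rule ccontr)
    define c where "c = f x - inner x z"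
    assume "f x \<noteq> inner x z"
    then have "c \<noteq> 0" by (simp add: c_def)
    \<comment> \<open>This is minimality of \<open>g\<close> at \<open>z\<close>, tested in the
      direction \<open>x\<close>; the left side is linear in \<open>t\<close> and the right side
      quadratic, which forces \<open>c = 0\<close>.\<close>
    have "2 * t * c \<le> t\<^sup>2 * (norm x)\<^sup>2" for t
      using min[of "z + t *\<^sub>R x"]
      unfolding g_def c_def power2_norm_eq_inner f.scaleR f.add
      by (simp add: inner_add_left inner_add_right inner_commute algebra_simps power2_eq_square)
    \<comment> \<open>This choice of \<open>t\<close> makes the linear term twice
      \<open>c\<^sup>2 / ((norm x)\<^sup>2 + 1)\<close>, while the quadratic term stays below that
      quantity. The \<open>+ 1\<close> keeps the denominator positive.\<close>
    from this[of "c / ((norm x)\<^sup>2 + 1)"]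
    have "2 * (c\<^sup>2 / ((norm x)\<^sup>2 + 1)) \<le> c\<^sup>2 / ((norm x)\<^sup>2 + 1) * ((norm x)\<^sup>2 / ((norm x)\<^sup>2 + 1))"
      by (simp add: power2_eq_square)
    also have "\<dots> \<le> c\<^sup>2 / ((norm x)\<^sup>2 + 1) * 1"
      by (intro mult_left_mono) (auto simp: divide_le_eq add_nonneg_pos)
    finally have "c\<^sup>2 / ((norm x)\<^sup>2 + 1) \<le> 0" by simp
    moreover have "c\<^sup>2 / ((norm x)\<^sup>2 + 1) > 0"
      using \<open>c \<noteq> 0\<close> by (simp add: add_nonneg_pos)
    ultimately show False by linarith
  qed
  with that show thesis .
qed

lemma bounded_ops_scaleC:
  "T \<in> bounded_ops \<Longrightarrow> blinfun_apply T (c *\<^sub>C x) = c *\<^sub>C blinfun_apply T x"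
  by (simp add: bounded_ops_def)

lemma bounded_ops_compose: "S \<in> bounded_ops \<Longrightarrow> T \<in> bounded_ops \<Longrightarrow> S o\<^sub>L T \<in> bounded_ops"
  by (simp add: bounded_ops_def)

lemma bounded_ops_uminus: "T \<in> bounded_ops \<Longrightarrow> - T \<in> bounded_ops"
  by (simp add: bounded_ops_def blinfun.minus_left scaleC_minus_right)

lemma bounded_ops_sum: "(\<And>i. i \<in> I \<Longrightarrow> T i \<in> bounded_ops) \<Longrightarrow> sum T I \<in> bounded_ops"
proof (induction I rule: infinite_finite_induct)
  case (insert i I)
  then show ?case by (simp add: bounded_ops_def blinfun.add_left scaleC_add_right)
qed (simp_all add: bounded_ops_def)

lemma bounded_adjoint_exists:
  fixes T :: "'a::complex_hilbert_space \<Rightarrow>\<^sub>L 'b::complex_hilbert_space"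
  assumes T: "T \<in> bounded_ops"
  obtains S where "\<And>x y. cinner (blinfun_apply T x) y = cinner x (blinfun_apply S y)"
proof -
  have "\<exists>z. \<forall>x. inner (blinfun_apply T x) y = inner x z" for y
  proof -
    have "bounded_linear (\<lambda>x. inner (blinfun_apply T x) y)"
      by (intro bounded_linear_intros)
    then show ?thesis
      using riesz_representation by blast
  qed
  then obtain s where s: "\<And>x y. inner (blinfun_apply T x) y = inner x (s y)"
    by metis
  have "bounded_linear s"
  proof (rule bounded_linear_intro[of _ "norm T"])
    show "s (x + y) = s x + s y" for x y
      by (rule inner_eqI) (metis inner_add_left inner_add_right inner_commute s)
    show "s (r *\<^sub>R x) = r *\<^sub>R s x" for r x
      by (rule inner_eqI) (metis inner_scaleR_left inner_scaleR_right inner_commute s)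
    show "norm (s y) \<le> norm y * norm T" for y
    proof -
      have "norm (s y) * norm (s y) = inner (blinfun_apply T (s y)) y"
        by (simp add: s power2_norm_eq_inner[symmetric] power2_eq_square)
      also have "\<dots> \<le> norm (blinfun_apply T (s y)) * norm y"
        by (rule norm_cauchy_schwarz)
      also have "\<dots> \<le> (norm T * norm (s y)) * norm y"
        by (intro mult_right_mono norm_blinfun) auto
      finally have "norm (s y) * norm (s y) \<le> (norm y * norm T) * norm (s y)"
        by (simp add: mult_ac)
      then show ?thesis
        by (cases "s y = 0") auto
    qed
  qed
  moreover have "cinner (blinfun_apply T x) y = cinner x (s y)" for x y
  proof (rule complex_eqI)
    show "Re (cinner (blinfun_apply T x) y) = Re (cinner x (s y))"
      using s[of x y] by (simp add: inner_eq_Re_cinner)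
    \<comment> \<open>Replacing \<open>x\<close> by \<open>\<i> *\<^sub>C x\<close> turns the real
      identity into the one for imaginary parts; this is where complex linearity of \<open>T\<close>
      enters.\<close>
    show "Im (cinner (blinfun_apply T x) y) = Im (cinner x (s y))"
      using s[of "\<i> *\<^sub>C x" y]
      by (simp add: inner_eq_Re_cinner bounded_ops_scaleC[OF T] cinner_scaleC_left)
  qed
  ultimately show thesis
    using that[of "Blinfun s"] by (simp add: bounded_linear_Blinfun_apply)
qed

text \<open>Justifies the definite description in \<open>bounded_adjoint\<close>: Riesz gives
  existence, and inner products separate points.\<close>

lemma cinner_bounded_adjoint:
  assumes "T \<in> bounded_ops"
  shows "cinner (blinfun_apply T x) y = cinner x (blinfun_apply (bounded_adjoint T) y)"
proof -
  obtain S where S: "\<And>x y. cinner (blinfun_apply T x) y = cinner x (blinfun_apply S y)"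
    using bounded_adjoint_exists[OF assms] by blast
  have "S' = S" if "\<forall>x y. cinner (blinfun_apply T x) y = cinner x (blinfun_apply S' y)" for S'
  proof (rule blinfun_eqI)
    fix y
    show "blinfun_apply S' y = blinfun_apply S y"
      by (rule cinner_eqI) (metis S that)
  qed
  then have "bounded_adjoint T = S"
    unfolding bounded_adjoint_def using S by (intro the_equality) auto
  with S show ?thesis by simp
qed

lemma bounded_adjoint_in_bounded_ops:
  assumes "T \<in> bounded_ops"
  shows "bounded_adjoint T \<in> bounded_ops"
  unfolding bounded_ops_def
proof (intro CollectI allI)
  fix c x
  have "cinner y (blinfun_apply (bounded_adjoint T) (c *\<^sub>C x)) =
      cinner y (c *\<^sub>C blinfun_apply (bounded_adjoint T) x)" for y
    by (metis assms cinner_bounded_adjoint cinner_scaleC_right)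
  then show "blinfun_apply (bounded_adjoint T) (c *\<^sub>C x) = c *\<^sub>C blinfun_apply (bounded_adjoint T) x"
    by (rule cinner_eqI)
qed


section \<open>Unbounded operators and resolvents\<close>

lemma op_app_eqI: "linear_operator T \<Longrightarrow> (x, y) \<in> T \<Longrightarrow> op_app T x = y"
  unfolding op_app_def by (rule the_equality) (auto simp: linear_operator_def dest: single_valuedD)

lemma op_dom_iff: "linear_operator T \<Longrightarrow> x \<in> op_dom T \<longleftrightarrow> (x, op_app T x) \<in> T"
  unfolding op_dom_def Domain_iff by (metis op_app_eqI)

lemma linear_operator_add:
  "linear_operator T \<Longrightarrow> (x, u) \<in> T \<Longrightarrow> (y, v) \<in> T \<Longrightarrow> (x + y, u + v) \<in> T"
  by (simp add: linear_operator_def)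

lemma linear_operator_scaleC:
  "linear_operator T \<Longrightarrow> (x, u) \<in> T \<Longrightarrow> (c *\<^sub>C x, c *\<^sub>C u) \<in> T"
  by (simp add: linear_operator_def)

lemma linear_operator_zero: "linear_operator T \<Longrightarrow> (0, 0) \<in> T"
  by (simp add: linear_operator_def)

lemma linear_operator_uminus: "linear_operator T \<Longrightarrow> (x, u) \<in> T \<Longrightarrow> (- x, - u) \<in> T"
  using linear_operator_scaleC[of T x u "-1"] by (simp add: scaleC_minus_one)

lemma linear_operator_diff:
  "linear_operator T \<Longrightarrow> (x, u) \<in> T \<Longrightarrow> (y, v) \<in> T \<Longrightarrow> (x - y, u - v) \<in> T"
  using linear_operator_add[of T x u "- y" "- v"] linear_operator_uminus[of T y v] by simp

lemma linear_operator_sum: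
  assumes "linear_operator T" "\<And>i. i \<in> I \<Longrightarrow> (f i, g i) \<in> T"
  shows "(sum f I, sum g I) \<in> T"
  using assms(2) by (induction I rule: infinite_finite_induct)
    (auto intro: linear_operator_zero linear_operator_add assms(1))

text \<open>The graph is an intersection of closed conditions, one for each vector of the domain.
  This yields closedness both of \<open>C\<close>, which equals its adjoint, and of
  \<open>adjoint_op A\<close> in the dual equation.\<close>

lemma closed_adjoint_op: "closed (adjoint_op T)"
proof -
  have "closed {p. cinner u (fst p) = cinner x (snd p)}" for u x :: 'a
    by (rule closed_Collect_eq)
      (auto intro!: continuous_on_compose2[OF continuous_on_cinner_right] continuous_intros)
  then have "closed (\<Inter>x\<in>op_dom T. {p. cinner (op_app T x) (fst p) = cinner x (snd p)})"
    by blast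
  also have "(\<Inter>x\<in>op_dom T. {p. cinner (op_app T x) (fst p) = cinner x (snd p)}) = adjoint_op T"
    by (auto simp: adjoint_op_def)
  finally show ?thesis .
qed

text \<open>Density makes the adjoint single-valued; linearity is immediate from the defining
  relation.\<close>

lemma linear_operator_adjoint_op:
  assumes "densely_defined T"
  shows "linear_operator (adjoint_op T)"
proof -
  have "u = v" if "(x, u) \<in> adjoint_op T" "(x, v) \<in> adjoint_op T" for x u v
  proof -
    have "u - v = 0"
    proof (rule cinner_eq_zero_dense)
      show "closure (op_dom T) = UNIV"
        using assms by (simp add: densely_defined_def)
      show "cinner y (u - v) = 0" if "y \<in> op_dom T" for y
        using that \<open>(x, u) \<in> adjoint_op T\<close> \<open>(x, v) \<in> adjoint_op T\<close>
        by (auto simp: adjoint_op_def cinner_diff_right)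
    qed
    then show ?thesis by simp
  qed
  then show ?thesis
    unfolding linear_operator_def single_valued_def
    by (auto simp: adjoint_op_def cinner_add_right cinner_scaleC_right)
qed

lemma resolvent_apply:
  assumes "l \<in> resolvent_set T"
  shows "blinfun_apply (resolvent T l) = shifted_inverse T l"
  using assms by (simp add: resolvent_def resolvent_set_def bounded_linear_Blinfun_apply)

lemma resolvent_graph:
  assumes "linear_operator T" "l \<in> resolvent_set T"
  shows "(blinfun_apply (resolvent T l) x, x + l *\<^sub>C blinfun_apply (resolvent T l) x) \<in> T"
proof -
  let ?f = "\<lambda>x. op_app T x - l *\<^sub>C x"
  have img: "?f ` op_dom T = UNIV"
    using assms(2) by (auto simp: resolvent_set_def bij_betw_def)
  then have x: "x \<in> ?f ` op_dom T" by simp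
  have "shifted_inverse T l x \<in> op_dom T"
    unfolding shifted_inverse_def using inv_into_into[OF x] .
  moreover have "?f (shifted_inverse T l x) = x"
    unfolding shifted_inverse_def using f_inv_into_f[OF x] .
  then have "op_app T (shifted_inverse T l x) = x + l *\<^sub>C shifted_inverse T l x"
    by (simp add: diff_eq_eq)
  ultimately show ?thesis
    using assms by (simp add: resolvent_apply op_dom_iff)
qed

lemma resolvent_eqI:
  assumes "linear_operator T" "l \<in> resolvent_set T" "(u, v) \<in> T"
  shows "blinfun_apply (resolvent T l) (v - l *\<^sub>C u) = u"
proof -
  let ?f = "\<lambda>x. op_app T x - l *\<^sub>C x"
  have "inj_on ?f (op_dom T)"
    using assms(2) by (auto simp: resolvent_set_def bij_betw_def)
  moreover have "u \<in> op_dom T" "op_app T u = v"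
    using assms by (auto simp: op_dom_def intro: op_app_eqI)
  ultimately show ?thesis
    using inv_into_f_f[of ?f "op_dom T" u] assms(2)
    by (simp add: resolvent_apply shifted_inverse_def)
qed

text \<open>\<open>resolvent_set\<close> asks for a real-linear bounded inverse only. Complex
  homogeneity is inherited from \<open>T\<close> by uniqueness of preimages.\<close>

lemma resolvent_in_bounded_ops:
  assumes T: "linear_operator T" and l: "l \<in> resolvent_set T"
  shows "resolvent T l \<in> bounded_ops"
  unfolding bounded_ops_def
proof (intro CollectI allI)
  fix c x
  let ?R = "blinfun_apply (resolvent T l)"
  have "(c *\<^sub>C ?R x, c *\<^sub>C (x + l *\<^sub>C ?R x)) \<in> T"
    by (intro linear_operator_scaleC resolvent_graph T l)
  from resolvent_eqI[OF T l this] show "?R (c *\<^sub>C x) = c *\<^sub>C ?R x"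
    by (simp add: scaleC_add_right scaleC_scaleC mult.commute)
qed

text \<open>A bounded two-sided inverse of \<open>T - l\<close> must coincide with
  \<open>shifted_inverse\<close>. This is how resolvent points of the adjoint are produced.\<close>

lemma resolvent_setI:
  fixes R :: "'a::complex_hilbert_space \<Rightarrow>\<^sub>L 'a"
  assumes T: "linear_operator T"
    and right: "\<And>x. (blinfun_apply R x, x + l *\<^sub>C blinfun_apply R x) \<in> T"
    and left: "\<And>u v. (u, v) \<in> T \<Longrightarrow> blinfun_apply R (v - l *\<^sub>C u) = u"
  shows "l \<in> resolvent_set T"
proof -
  let ?f = "\<lambda>x. op_app T x - l *\<^sub>C x"
  have Rf: "blinfun_apply R (?f u) = u" if "u \<in> op_dom T" for u
    using that left op_dom_iff[OF T] by blast
  have fR: "?f (blinfun_apply R x) = x" and Rd: "blinfun_apply R x \<in> op_dom T" for x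
    using op_app_eqI[OF T right, of x] right[of x] by (auto simp: op_dom_def)
  have bij: "bij_betw ?f (op_dom T) UNIV"
    by (rule bij_betw_byWitness[of _ "blinfun_apply R"]) (auto simp: Rf fR Rd)
  have "shifted_inverse T l x = blinfun_apply R x" for x
    unfolding shifted_inverse_def
    by (rule inv_into_f_eq[OF bij_betw_imp_inj_on[OF bij] Rd fR])
  then have "shifted_inverse T l = blinfun_apply R" by blast
  then show ?thesis
    using bij by (simp add: resolvent_set_def blinfun.bounded_linear_right)
qed

text \<open>The inverse of the shifted adjoint is the bounded adjoint of
  \<open>resolvent T l\<close>: moving it across \<open>cinner\<close> reduces each one-sided
  identity to the other one for \<open>resolvent T l\<close>.\<close>

lemma cnj_in_resolvent_set_adjoint:
  fixes T :: "('a::complex_hilbert_space \<times> 'a) set"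
  assumes T: "linear_operator T" and dense: "densely_defined T" and l: "l \<in> resolvent_set T"
  shows "cnj l \<in> resolvent_set (adjoint_op T)"
proof (rule resolvent_setI)
  let ?R = "resolvent T l"
  note R = resolvent_in_bounded_ops[OF T l]
  show "linear_operator (adjoint_op T)"
    by (rule linear_operator_adjoint_op[OF dense])
  fix y
  let ?z = "blinfun_apply (bounded_adjoint ?R) y"
  have "cinner (op_app T x) ?z = cinner x (y + cnj l *\<^sub>C ?z)" if "x \<in> op_dom T" for x
  proof -
    have "cinner (op_app T x - l *\<^sub>C x) ?z = cinner x y"
      using resolvent_eqI[OF T l] that op_dom_iff[OF T]
      by (simp add: cinner_bounded_adjoint[OF R, symmetric])
    then show ?thesis
      by (simp add: cinner_diff_left cinner_add_right cinner_scaleC_left cinner_scaleC_right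
          algebra_simps)
  qed
  then show "(?z, y + cnj l *\<^sub>C ?z) \<in> adjoint_op T"
    by (auto simp: adjoint_op_def)
next
  let ?R = "resolvent T l"
  note R = resolvent_in_bounded_ops[OF T l]
  fix u v assume uv: "(u, v) \<in> adjoint_op T"
  have "cinner x (blinfun_apply (bounded_adjoint ?R) (v - cnj l *\<^sub>C u)) = cinner x u" for x
  proof -
    have g: "(blinfun_apply ?R x, x + l *\<^sub>C blinfun_apply ?R x) \<in> T"
      by (rule resolvent_graph[OF T l])
    have "cinner x (blinfun_apply (bounded_adjoint ?R) (v - cnj l *\<^sub>C u)) =
        cinner (blinfun_apply ?R x) v - cinner (l *\<^sub>C blinfun_apply ?R x) u"
      by (simp add: cinner_bounded_adjoint[OF R, symmetric] cinner_diff_right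
          cinner_scaleC_left cinner_scaleC_right)
    also have "cinner (blinfun_apply ?R x) v = cinner (op_app T (blinfun_apply ?R x)) u"
      using uv DomainI[OF g] unfolding adjoint_op_def op_dom_def by force
    also have "op_app T (blinfun_apply ?R x) = x + l *\<^sub>C blinfun_apply ?R x"
      by (rule op_app_eqI[OF T g])
    finally show ?thesis by (simp add: cinner_add_left)
  qed
  then show "blinfun_apply (bounded_adjoint ?R) (v - cnj l *\<^sub>C u) = u"
    by (rule cinner_eqI)
qed

text \<open>This follows from the resolvent identity \<open>R k = R l + (k - l) R l R k\<close>.\<close>

lemma norm_resolvent_near:
  assumes T: "linear_operator T" and l: "l \<in> resolvent_set T" and k: "k \<in> resolvent_set T"
    and near: "cmod (k - l) * norm (resolvent T l) \<le> 1/2"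
  shows "norm (resolvent T k) \<le> 2 * norm (resolvent T l)"
proof -
  let ?L = "resolvent T l" and ?K = "resolvent T k"
  have eq: "blinfun_apply ?K x = blinfun_apply ?L x + (k - l) *\<^sub>C blinfun_apply ?L (blinfun_apply ?K x)"
    for x
  proof -
    have "blinfun_apply ?L (x + k *\<^sub>C blinfun_apply ?K x - l *\<^sub>C blinfun_apply ?K x) = blinfun_apply ?K x"
      by (rule resolvent_eqI[OF T l resolvent_graph[OF T k]])
    moreover have "x + k *\<^sub>C blinfun_apply ?K x - l *\<^sub>C blinfun_apply ?K x
        = x + (k - l) *\<^sub>C blinfun_apply ?K x"
      by (simp add: scaleC_diff_left)
    ultimately show ?thesis
      by (simp add: blinfun.add_right bounded_ops_scaleC[OF resolvent_in_bounded_ops[OF T l]])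
  qed
  show ?thesis
  proof (rule norm_blinfun_bound)
    fix x
    have "norm (blinfun_apply ?K x)
        \<le> norm (blinfun_apply ?L x) + cmod (k - l) * norm (blinfun_apply ?L (blinfun_apply ?K x))"
      by (subst eq) (metis norm_triangle_ineq norm_scaleC)
    also have "\<dots> \<le> norm ?L * norm x + cmod (k - l) * (norm ?L * norm (blinfun_apply ?K x))"
      by (intro add_mono mult_left_mono norm_blinfun) auto
    \<comment> \<open>Half of the quantity being estimated appears on the right and is absorbed on
      the left, which produces the factor 2.\<close>
    also have "\<dots> \<le> norm ?L * norm x + 1/2 * norm (blinfun_apply ?K x)"
      using mult_right_mono[OF near, of "norm (blinfun_apply ?K x)"] by (simp add: mult.assoc)
    finally show "norm (blinfun_apply ?K x) \<le> 2 * norm ?L * norm x" by simp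
  qed auto
qed

lemma resolvent_bounded_on_compact:
  assumes T: "linear_operator T" and "compact K" and K: "K \<subseteq> resolvent_set T"
  obtains M where "\<And>l. l \<in> K \<Longrightarrow> norm (resolvent T l) \<le> M"
proof -
  \<comment> \<open>The radius is such that \<open>norm_resolvent_near\<close> applies throughout
    the ball; the \<open>+ 1\<close> covers a resolvent of norm zero.\<close>
  let ?e = "\<lambda>l. 1 / (2 * (norm (resolvent T l) + 1))"
  have e: "?e l > 0" for l
    by (simp add: add_nonneg_pos)
  obtain D where D: "D \<subseteq> K" "finite D" "K \<subseteq> (\<Union>l\<in>D. ball l (?e l))"
  proof (rule compactE_image[OF \<open>compact K\<close>, of K "\<lambda>l. ball l (?e l)"])
    show "K \<subseteq> (\<Union>l\<in>K. ball l (?e l))"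
      using e centre_in_ball by blast
  qed auto
  \<comment> \<open>A sum over the finitely many centres dominates each summand and also makes sense
    when there are no centres.\<close>
  define M where "M = (\<Sum>l\<in>D. 2 * norm (resolvent T l))"
  have "norm (resolvent T k) \<le> M" if "k \<in> K" for k
  proof -
    obtain l where l: "l \<in> D" "k \<in> ball l (?e l)"
      using D(3) \<open>k \<in> K\<close> by blast
    have "cmod (k - l) < ?e l"
      using l(2) by (simp add: dist_norm norm_minus_commute)
    then have "cmod (k - l) * norm (resolvent T l) \<le> ?e l * norm (resolvent T l)"
      by (intro mult_right_mono) auto
    also have "\<dots> \<le> 1/2"
      by (simp add: divide_simps add_nonneg_pos)
    finally have "norm (resolvent T k) \<le> 2 * norm (resolvent T l)"
      using norm_resolvent_near[OF T] K D(1) l(1) \<open>k \<in> K\<close> by blast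
    also have "\<dots> \<le> M"
      unfolding M_def using l(1) D(2) by (intro member_le_sum) auto
    finally show ?thesis .
  qed
  with that show thesis .
qed

section \<open>Projection-valued measures\<close>

locale pvm =
  fixes E :: "real set \<Rightarrow> ('a::complex_hilbert_space \<Rightarrow>\<^sub>L 'a)"
  assumes pvm: "projection_valued_measure E"
begin

lemma E_in_bounded_ops: "B \<in> sets borel \<Longrightarrow> E B \<in> bounded_ops"
  using pvm by (simp add: projection_valued_measure_def orthogonal_projection_def)

lemma E_idem: "B \<in> sets borel \<Longrightarrow> E B (E B x) = E B x"
  using pvm unfolding projection_valued_measure_def orthogonal_projection_def
  by (metis blinfun_apply_blinfun_compose)

lemma cinner_E: "B \<in> sets borel \<Longrightarrow> cinner (E B x) y = cinner x (E B y)"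
  using pvm by (simp add: projection_valued_measure_def orthogonal_projection_def)

lemma inner_E: "B \<in> sets borel \<Longrightarrow> inner (E B x) y = inner x (E B y)"
  by (simp add: inner_eq_Re_cinner cinner_E)

lemma E_UNIV [simp]: "E UNIV x = x"
  using pvm by (simp add: projection_valued_measure_def)

lemma E_sums:
  fixes F :: "nat \<Rightarrow> real set"
  assumes "range F \<subseteq> sets borel" "disjoint_family F"
  shows "(\<lambda>n. E (F n) x) sums E (\<Union>n. F n) x"
  using pvm assms by (simp add: projection_valued_measure_def)

lemma E_empty [simp]: "E {} x = 0"
proof -
  have "(\<lambda>n::nat. E {} x) sums E (\<Union>n::nat. {}) x"
    by (rule E_sums) (auto simp: disjoint_family_on_def)
  then have "(\<lambda>n::nat. E {} x) \<longlonglongrightarrow> 0"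
    using sums_summable summable_LIMSEQ_zero by blast
  then show ?thesis
    by (simp add: LIMSEQ_const_iff)
qed

lemma E_Un:
  assumes "A \<in> sets borel" "B \<in> sets borel" "A \<inter> B = {}"
  shows "E (A \<union> B) x = E A x + E B x"
proof -
  have "(\<lambda>n. E (binaryset A B n) x) sums E (\<Union>n. binaryset A B n) x"
    using assms by (intro E_sums)
      (auto simp: range_binaryset_eq disjoint_family_on_def binaryset_def)
  moreover have "(\<lambda>n. E (binaryset A B n) x) sums (\<Sum>n\<in>{0,1}. E (binaryset A B n) x)"
    by (rule sums_finite) (auto simp: binaryset_def)
  ultimately have "E (\<Union>n. binaryset A B n) x = (\<Sum>n\<in>{0,1}. E (binaryset A B n) x)"
    by (rule sums_unique2)
  then show ?thesis
    by (simp add: UN_binaryset_eq) (simp add: binaryset_def)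
qed

lemma E_Compl: "B \<in> sets borel \<Longrightarrow> E (- B) x = x - E B x"
  by (metis E_UNIV E_Un Compl_disjoint Compl_partition add_diff_cancel_left' borel_comp)

lemma norm_E_sq: "B \<in> sets borel \<Longrightarrow> (norm (E B x))\<^sup>2 = inner x (E B x)"
  by (simp add: power2_norm_eq_inner inner_E E_idem)

lemma norm_E_le:
  assumes "B \<in> sets borel"
  shows "norm (E B x) \<le> norm x"
proof (cases "E B x = 0")
  case False
  have "norm (E B x) * norm (E B x) \<le> norm x * norm (E B x)"
    using norm_E_sq[OF assms, of x] norm_cauchy_schwarz[of x "E B x"] by (simp add: power2_eq_square)
  then show ?thesis
    using False by simp
qed simp

text \<open>Multiplicativity is not part of the definition of the measure. It comes from additivity:
  for \<open>y = E B x\<close> the projection on \<open>A \<union> B\<close> would have squared norm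
  \<open>(norm (E A y))\<^sup>2 + (norm y)\<^sup>2\<close>, yet it cannot exceed
  \<open>(norm y)\<^sup>2\<close>.\<close>

lemma E_disjoint:
  assumes "A \<in> sets borel" "B \<in> sets borel" "A \<inter> B = {}"
  shows "E A (E B x) = 0"
proof -
  define y where "y = E B x"
  have "(norm (E (A \<union> B) y))\<^sup>2 = (norm (E A y))\<^sup>2 + (norm (E B y))\<^sup>2"
    using assms norm_E_sq[of "A \<union> B" y] norm_E_sq[of A y] norm_E_sq[of B y]
    by (simp add: E_Un inner_add_right)
  moreover have "E B y = y"
    using assms by (simp add: y_def E_idem)
  moreover have "(norm (E (A \<union> B) y))\<^sup>2 \<le> (norm y)\<^sup>2"
    using assms by (intro power_mono norm_E_le) auto
  ultimately have "(norm (E A y))\<^sup>2 \<le> 0" by simp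
  then show ?thesis by (simp add: y_def)
qed

text \<open>Both sets are split along \<open>A \<inter> B\<close>; \<open>E_disjoint\<close> kills
  the remainders and idempotence handles the common part.\<close>

lemma E_Int:
  assumes A [measurable]: "A \<in> sets borel" and B [measurable]: "B \<in> sets borel"
  shows "E A (E B x) = E (A \<inter> B) x"
proof -
  have "E B x = E ((A \<inter> B) \<union> (B - A)) x"
    by (rule arg_cong[where f = "\<lambda>S. blinfun_apply (E S) x"]) auto
  also have "\<dots> = E (A \<inter> B) x + E (B - A) x"
    by (rule E_Un) auto
  finally have "E A (E B x) = E A (E (A \<inter> B) x) + E A (E (B - A) x)"
    by (simp add: blinfun.add_right)
  also have "E A (E (B - A) x) = 0"
    by (rule E_disjoint) auto
  also have "E A (E (A \<inter> B) x) = E ((A \<inter> B) \<union> (A - B)) (E (A \<inter> B) x)"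
    by (rule arg_cong[where f = "\<lambda>S. blinfun_apply (E S) _"]) auto
  also have "\<dots> = E (A \<inter> B) (E (A \<inter> B) x) + E (A - B) (E (A \<inter> B) x)"
    by (rule E_Un) auto
  also have "E (A - B) (E (A \<inter> B) x) = 0"
    by (rule E_disjoint) auto
  also have "E (A \<inter> B) (E (A \<inter> B) x) = E (A \<inter> B) x"
    by (rule E_idem) auto
  finally show ?thesis by simp
qed

lemma orthogonal_E_E:
  assumes "A \<in> sets borel" "B \<in> sets borel" "A \<inter> B = {}"
  shows "orthogonal (E A x) (E B y)"
  using assms by (simp add: orthogonal_def inner_E E_disjoint)

lemma space_scalar_measure [simp]: "space (scalar_measure E x) = UNIV"
  by (simp add: scalar_measure_def space_measure_of_conv)

lemma sets_scalar_measure [simp, measurable_cong]: "sets (scalar_measure E x) = sets borel"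
  using sets.sigma_sets_eq[of borel] by (simp add: scalar_measure_def)

text \<open>\<open>measure_of\<close> returns the prescribed set function only once countable
  additivity is known. The value is a squared norm because \<open>E B\<close> is a
  projection.\<close>

lemma emeasure_scalar_measure:
  assumes "B \<in> sets borel"
  shows "emeasure (scalar_measure E x) B = ennreal ((norm (E B x))\<^sup>2)"
proof -
  let ?f = "\<lambda>B. ennreal (Re (cinner x (E B x)))"
  have "countably_additive (sets borel) ?f"
  proof (rule countably_additiveI)
    fix A :: "nat \<Rightarrow> real set"
    assume A: "range A \<subseteq> sets borel" "disjoint_family A"
    have "(\<lambda>n. inner x (E (A n) x)) sums inner x (E (\<Union>n. A n) x)"
      by (rule bounded_linear.sums[OF bounded_linear_inner_right E_sums[OF A]])
    moreover have "inner x (E (A n) x) \<ge> 0" for n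
      using A norm_E_sq[of "A n" x] by (metis range_subsetD zero_le_power2)
    ultimately show "(\<Sum>n. ?f (A n)) = ?f (\<Union>n. A n)"
      unfolding inner_eq_Re_cinner[symmetric] by (intro suminf_ennreal_eq)
  qed
  moreover have "positive (sets borel) ?f"
    by (simp add: positive_def)
  moreover have "sigma_algebra (UNIV :: real set) (sets borel)"
    using sets.sigma_algebra_axioms[of "borel :: real measure"] by simp
  ultimately have "emeasure (scalar_measure E x) B = ?f B"
    unfolding scalar_measure_def by (intro emeasure_measure_of_sigma assms)
  then show ?thesis
    by (simp add: norm_E_sq[OF assms] inner_eq_Re_cinner)
qed

lemma finite_measure_scalar_measure: "finite_measure (scalar_measure E x)"
  by (rule finite_measureI) (simp add: emeasure_scalar_measure)

lemma measure_scalar_measure: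
  "B \<in> sets borel \<Longrightarrow> measure (scalar_measure E x) B = (norm (E B x))\<^sup>2"
  by (simp add: measure_def emeasure_scalar_measure)

text \<open>By \<open>E_Int\<close>, projecting the vector restricts its scalar measure to
  \<open>B\<close>. Integrability and quadratic forms at \<open>E B x\<close> thereby become
  statements about integrals over \<open>B\<close>.\<close>

lemma scalar_measure_E:
  assumes "B \<in> sets borel"
  shows "scalar_measure E (E B x) = density (scalar_measure E x) (indicator B)"
proof (rule measure_eqI)
  fix D assume "D \<in> sets (scalar_measure E (E B x))"
  then show "emeasure (scalar_measure E (E B x)) D =
      emeasure (density (scalar_measure E x) (indicator B)) D"
    using assms by (simp add: emeasure_restricted emeasure_scalar_measure E_Int Int_commute)
qed simp

lemma integrable_scalar_measure_E:
  fixes f :: "real \<Rightarrow> real"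
  assumes [measurable]: "B \<in> sets borel" "f \<in> borel_measurable borel"
  shows "integrable (scalar_measure E (E B x)) f \<longleftrightarrow>
    integrable (scalar_measure E x) (\<lambda>t. indicator B t * f t)"
  using integrable_density[of f "scalar_measure E x" "indicator B"]
  by (simp add: scalar_measure_E ennreal_indicator)

lemma integral_scalar_measure_E:
  fixes f :: "real \<Rightarrow> real"
  assumes [measurable]: "B \<in> sets borel" "f \<in> borel_measurable borel"
  shows "(\<integral>t. f t \<partial>scalar_measure E (E B x)) = (\<integral>t. indicator B t * f t \<partial>scalar_measure E x)"
  using integral_density[of f "scalar_measure E x" "indicator B"]
  by (simp add: scalar_measure_E ennreal_indicator)

lemma AE_scalar_measure_E:
  assumes [measurable]: "B \<in> sets borel"
  shows "AE t in scalar_measure E (E B x). t \<in> B"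
  unfolding scalar_measure_E[OF assms] by (subst AE_density) (auto simp: indicator_def)

text \<open>\<open>E U x = 0\<close> says that \<open>U\<close> is a null set of the scalar measure
  at \<open>x\<close>, so the usual rules for countable unions and subsets apply.\<close>

lemma E_null_Union:
  assumes "countable \<U>" "\<And>U. U \<in> \<U> \<Longrightarrow> U \<in> sets borel" "\<And>U. U \<in> \<U> \<Longrightarrow> E U x = 0"
    and "B \<in> sets borel" "B \<subseteq> \<Union>\<U>"
  shows "E B x = 0"
proof -
  have "(\<Union>U\<in>\<U>. U) \<in> null_sets (scalar_measure E x)"
    using assms(2,3)
    by (intro null_sets_UN' assms(1)) (simp add: null_sets_def emeasure_scalar_measure)
  then have "B \<in> null_sets (scalar_measure E x)"
    by (rule null_sets_subset) (use assms(4,5) in simp_all)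
  then show ?thesis
    using assms(4) by (auto simp: null_sets_def emeasure_scalar_measure)
qed

text \<open>Continuity from below gives one window carrying all but \<open>e\<^sup>2\<close> of the
  mass of \<open>x\<close>. Every larger window carries at least as much, and Pythagoras turns the
  missing mass into a distance; this handles both endpoints at once.\<close>

lemma tendsto_E_interval: "((\<lambda>(a, b). E {a..<b} x) \<longlongrightarrow> x) (at_bot \<times>\<^sub>F at_top)"
proof (rule tendstoI)
  fix e :: real assume "e > 0"
  interpret finite_measure "scalar_measure E x"
    by (rule finite_measure_scalar_measure)
  let ?I = "\<lambda>n. {- real n..<real n}"
  have "(\<lambda>n. measure (scalar_measure E x) (?I n)) \<longlonglongrightarrow> measure (scalar_measure E x) (\<Union>n. ?I n)"
    by (rule finite_Lim_measure_incseq) (auto simp: incseq_def)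
  moreover have "(\<Union>n. ?I n) = UNIV"
  proof -
    have "\<exists>n. t \<in> ?I n" for t :: real
    proof -
      obtain n where "real n > \<bar>t\<bar>" using reals_Archimedean2 by blast
      then show ?thesis by (intro exI[of _ n]) auto
    qed
    then show ?thesis by blast
  qed
  ultimately have "(\<lambda>n. (norm (E (?I n) x))\<^sup>2) \<longlonglongrightarrow> (norm x)\<^sup>2"
    by (simp add: measure_scalar_measure)
  then have "\<forall>\<^sub>F n in sequentially. (norm (E (?I n) x))\<^sup>2 > (norm x)\<^sup>2 - e\<^sup>2"
    using \<open>e > 0\<close> by (intro order_tendstoD) auto
  then obtain n where n: "(norm (E (?I n) x))\<^sup>2 > (norm x)\<^sup>2 - e\<^sup>2"
    using eventually_happens trivial_limit_sequentially by blast
  have close: "dist (E {a..<b} x) x < e" if "a \<le> - real n" "b \<ge> real n" for a b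
  proof -
    have "E (?I n) x = E (?I n) (E {a..<b} x)"
      using that by (simp add: E_Int Int_absorb2 atLeastLessThan_subset_iff)
    then have "(norm (E (?I n) x))\<^sup>2 \<le> (norm (E {a..<b} x))\<^sup>2"
      by (metis norm_E_le power_mono norm_ge_zero atLeastLessThan_borel)
    moreover have "(norm (x - E {a..<b} x))\<^sup>2 = (norm x)\<^sup>2 - (norm (E {a..<b} x))\<^sup>2"
      using norm_E_sq[of "- {a..<b}" x] norm_E_sq[of "{a..<b}" x]
      by (simp add: E_Compl inner_diff_right power2_norm_eq_inner)
    ultimately have "(norm (x - E {a..<b} x))\<^sup>2 < e\<^sup>2"
      using n by linarith
    then have "norm (x - E {a..<b} x) < e"
      using \<open>e > 0\<close> by (simp add: power2_less_imp_less)
    then show ?thesis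
      by (simp add: dist_norm norm_minus_commute)
  qed
  have "\<forall>\<^sub>F (a, b) in at_bot \<times>\<^sub>F at_top. a \<le> - real n \<and> b \<ge> real n"
    by (rule eventually_prodI[OF eventually_le_at_bot eventually_ge_at_top, THEN eventually_mono]) auto
  then show "\<forall>\<^sub>F p in at_bot \<times>\<^sub>F at_top. dist (case p of (a, b) \<Rightarrow> E {a..<b} x) x < e"
    by (rule eventually_mono) (use close in auto)
qed

end


section \<open>Spectral resolution of a self-adjoint operator\<close>

locale spectral_resolution =
  fixes C :: "('a::complex_hilbert_space \<times> 'a) set" and E :: "real set \<Rightarrow> ('a \<Rightarrow>\<^sub>L 'a)"
  assumes self_adjoint: "self_adjoint C" and spectral_measure: "is_spectral_measure C E"

sublocale spectral_resolution \<subseteq> pvm E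
  using spectral_measure by unfold_locales (simp add: is_spectral_measure_def)

context spectral_resolution
begin

lemma linear_operator_C: "linear_operator C"
  using self_adjoint by (simp add: self_adjoint_def)

lemma closed_C: "closed C"
  using closed_adjoint_op[of C] self_adjoint by (simp add: self_adjoint_def)

lemma closure_dom_C: "closure (op_dom C) = UNIV"
  using self_adjoint by (simp add: self_adjoint_def densely_defined_def)

lemma dom_C_iff: "x \<in> op_dom C \<longleftrightarrow> integrable (scalar_measure E x) (\<lambda>t. t\<^sup>2)"
  using spectral_measure by (simp add: is_spectral_measure_def)

lemma C_graph: "x \<in> op_dom C \<Longrightarrow> (x, op_app C x) \<in> C"
  using op_dom_iff[OF linear_operator_C] by simp

lemma C_add:
  "x \<in> op_dom C \<Longrightarrow> y \<in> op_dom C \<Longrightarrow> x + y \<in> op_dom C \<and> op_app C (x + y) = op_app C x + op_app C y"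
  using linear_operator_add[OF linear_operator_C C_graph C_graph]
  by (auto simp: op_dom_def intro: op_app_eqI[OF linear_operator_C])

lemma C_diff:
  "x \<in> op_dom C \<Longrightarrow> y \<in> op_dom C \<Longrightarrow> x - y \<in> op_dom C \<and> op_app C (x - y) = op_app C x - op_app C y"
  using linear_operator_diff[OF linear_operator_C C_graph C_graph]
  by (auto simp: op_dom_def intro: op_app_eqI[OF linear_operator_C])

lemma C_scaleC:
  "x \<in> op_dom C \<Longrightarrow> c *\<^sub>C x \<in> op_dom C \<and> op_app C (c *\<^sub>C x) = c *\<^sub>C op_app C x"
  using linear_operator_scaleC[OF linear_operator_C C_graph]
  by (auto simp: op_dom_def intro: op_app_eqI[OF linear_operator_C])

lemma C_symmetric:
  assumes "x \<in> op_dom C" "y \<in> op_dom C"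
  shows "cinner (op_app C x) y = cinner x (op_app C y)"
proof -
  have "(y, op_app C y) \<in> adjoint_op C"
    using C_graph[OF assms(2)] self_adjoint by (simp add: self_adjoint_def)
  then show ?thesis
    using assms(1) by (simp add: adjoint_op_def)
qed

lemma integrable_id:
  assumes "x \<in> op_dom C"
  shows "integrable (scalar_measure E x) (\<lambda>t. t)"
proof -
  interpret finite_measure "scalar_measure E x"
    by (rule finite_measure_scalar_measure)
  have "integrable (scalar_measure E x) (\<lambda>t. 1 + t\<^sup>2)"
    using assms by (simp add: dom_C_iff)
  then show ?thesis
  proof (rule Bochner_Integration.integrable_bound)
    have "\<bar>t\<bar> \<le> 1 + t\<^sup>2" for t :: real
      using sum_squares_bound[of 1 "\<bar>t\<bar>"] by simp
    then show "AE t in scalar_measure E x. norm t \<le> norm (1 + t\<^sup>2)"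
      by simp
  qed simp
qed

lemma C_form:
  "x \<in> op_dom C \<Longrightarrow> inner x (op_app C x) = (\<integral>t. t \<partial>scalar_measure E x)"
  using spectral_measure by (simp add: is_spectral_measure_def inner_eq_Re_cinner)

lemma E_in_dom:
  assumes [measurable]: "B \<in> sets borel" and "x \<in> op_dom C"
  shows "E B x \<in> op_dom C"
proof -
  have "integrable (scalar_measure E x) (\<lambda>t. indicator B t * t\<^sup>2)"
    using assms(2) integrable_real_mult_indicator[of B "scalar_measure E x" "\<lambda>t. t\<^sup>2"]
    by (simp add: dom_C_iff mult.commute)
  then show ?thesis
    by (simp add: dom_C_iff integrable_scalar_measure_E)
qed

lemma E_bounded_in_dom:
  assumes [measurable]: "B \<in> sets borel" and "bounded B"
  shows "E B x \<in> op_dom C"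
proof -
  interpret finite_measure "scalar_measure E x"
    by (rule finite_measure_scalar_measure)
  obtain b where "\<And>t. t \<in> B \<Longrightarrow> \<bar>t\<bar> \<le> b"
    using assms(2) by (auto simp: bounded_iff)
  then have "t\<^sup>2 \<le> b\<^sup>2" if "t \<in> B" for t
    using that by (metis abs_ge_zero power2_abs power_mono)
  then have "integrable (scalar_measure E x) (\<lambda>t. indicator B t * t\<^sup>2)"
    by (intro integrable_const_bound[of _ "b\<^sup>2"]) (auto simp: indicator_def)
  then show ?thesis
    by (simp add: dom_C_iff integrable_scalar_measure_E)
qed

text \<open>The form is an integral, hence additive over \<open>B\<close> and its complement. No
  mixed terms occur, and that is the source of commutation with \<open>C\<close>.\<close>

lemma C_form_split:
  assumes B [measurable]: "B \<in> sets borel" and x: "x \<in> op_dom C"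
  shows "inner x (op_app C x) =
    inner (E B x) (op_app C (E B x)) + inner (E (- B) x) (op_app C (E (- B) x))"
proof -
  have int: "integrable (scalar_measure E x) (\<lambda>t. indicator D t * t)" if "D \<in> sets borel" for D
    using that integrable_real_mult_indicator[OF _ integrable_id[OF x], of D]
    by (simp add: mult.commute)
  have "(\<integral>t. t \<partial>scalar_measure E x) =
      (\<integral>t. indicator B t * t + indicator (- B) t * t \<partial>scalar_measure E x)"
    by (rule Bochner_Integration.integral_cong) (auto simp: indicator_def)
  also have "\<dots> = (\<integral>t. indicator B t * t \<partial>scalar_measure E x) +
      (\<integral>t. indicator (- B) t * t \<partial>scalar_measure E x)"
    using int B by (intro Bochner_Integration.integral_add) auto
  finally show ?thesis
    using x by (simp add: C_form E_in_dom integral_scalar_measure_E)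
qed

text \<open>Expanding the form at \<open>v + u\<close> and comparing with
  \<open>C_form_split\<close> makes the two real cross terms cancel; by symmetry of \<open>C\<close>
  they are equal, so each is zero.\<close>

lemma C_form_cross:
  assumes B [measurable]: "B \<in> sets borel" and v: "v \<in> op_dom C" "E B v = v"
    and w: "w \<in> op_dom C" "E B w = 0"
  shows "cinner v (op_app C w) = 0"
proof -
  have re: "inner v (op_app C u) = 0" if u: "u \<in> op_dom C" "E B u = 0" for u
  proof -
    have "E B (v + u) = v" "E (- B) (v + u) = u"
      using v u by (simp_all add: E_Compl blinfun.add_right)
    then have "inner (v + u) (op_app C v + op_app C u) = inner v (op_app C v) + inner u (op_app C u)"
      using C_form_split[OF B, of "v + u"] C_add[OF v(1) u(1)] by simp
    then have "inner v (op_app C u) + inner u (op_app C v) = 0"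
      by (simp add: inner_add_left inner_add_right)
    moreover have "inner u (op_app C v) = inner v (op_app C u)"
      using C_symmetric[OF u(1) v(1)] by (metis inner_commute inner_eq_Re_cinner)
    ultimately show ?thesis by simp
  qed
  \<comment> \<open>The imaginary part follows by applying the real case to
    \<open>(- \<i>) *\<^sub>C w\<close>, which satisfies the same assumptions as
    \<open>w\<close>.\<close>
  have "inner v ((- \<i>) *\<^sub>C op_app C w) = 0"
    using re[of "(- \<i>) *\<^sub>C w"] C_scaleC[OF w(1), of "- \<i>"] w(2)
    by (simp add: bounded_ops_scaleC[OF E_in_bounded_ops[OF B]])
  with re[OF w] show ?thesis
    by (simp add: cinner_conv_inner complex_eq_iff)
qed

text \<open>Tested against \<open>g\<close> in the dense domain, the projection moves over to
  \<open>g\<close>, and \<open>C_form_cross\<close> applies to \<open>E B g\<close> and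
  \<open>w\<close>.\<close>

lemma E_C_eq_0:
  assumes B: "B \<in> sets borel" and w: "w \<in> op_dom C" "E B w = 0"
  shows "E B (op_app C w) = 0"
proof (rule cinner_eq_zero_dense[OF closure_dom_C])
  fix g assume "g \<in> op_dom C"
  then have "cinner (E B g) (op_app C w) = 0"
    using B w by (intro C_form_cross[OF B]) (simp_all add: E_in_dom E_idem)
  then show "cinner g (E B (op_app C w)) = 0"
    by (simp add: cinner_E[OF B])
qed

text \<open>Split \<open>x\<close> into \<open>E B x\<close> and the rest, and use
  \<open>E_C_eq_0\<close> for the complement on the first piece and for \<open>B\<close> on the
  second.\<close>

lemma E_C_commute:
  assumes B: "B \<in> sets borel" and x: "x \<in> op_dom C"
  shows "E B (op_app C x) = op_app C (E B x)"
proof -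
  note dom = E_in_dom[OF B x]
  have "E B (op_app C (x - E B x)) = 0"
    using C_diff[OF x dom] B by (intro E_C_eq_0) (simp_all add: blinfun.diff_right E_idem)
  moreover have "E (- B) (op_app C (E B x)) = 0"
    using dom B by (intro E_C_eq_0) (simp_all add: E_Compl E_idem)
  ultimately show ?thesis
    using C_diff[OF x dom] B by (simp add: blinfun.diff_right E_Compl)
qed

text \<open>This is \<open>C - r\<close>, meaningful on \<open>op_dom C\<close> only. A real
  \<open>r\<close> keeps it symmetric, as polarization requires.\<close>

definition shift :: "real \<Rightarrow> 'a \<Rightarrow> 'a" where
  "shift r x = op_app C x - complex_of_real r *\<^sub>C x"

lemma shift_add:
  "x \<in> op_dom C \<Longrightarrow> y \<in> op_dom C \<Longrightarrow> shift r (x + y) = shift r x + shift r y"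
  by (simp add: shift_def C_add scaleC_add_right)

lemma shift_diff:
  "x \<in> op_dom C \<Longrightarrow> y \<in> op_dom C \<Longrightarrow> shift r (x - y) = shift r x - shift r y"
  by (simp add: shift_def C_diff scaleC_diff_right)

lemma E_shift_commute: "B \<in> sets borel \<Longrightarrow> x \<in> op_dom C \<Longrightarrow> E B (shift r x) = shift r (E B x)"
  by (simp add: shift_def blinfun.diff_right E_C_commute bounded_ops_scaleC[OF E_in_bounded_ops])

lemma shift_symmetric:
  "x \<in> op_dom C \<Longrightarrow> y \<in> op_dom C \<Longrightarrow> inner (shift r x) y = inner x (shift r y)"
  by (simp add: shift_def inner_eq_Re_cinner cinner_diff_left cinner_diff_right C_symmetric
      cinner_scaleC_left cinner_scaleC_right)

text \<open>Since \<open>E B x = x\<close>, the scalar measure of \<open>x\<close> lives on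
  \<open>B\<close>, where the integrand is at most \<open>c\<close>; its total mass is
  \<open>(norm x)\<^sup>2\<close>.\<close>

lemma shift_form_bound:
  assumes B [measurable]: "B \<in> sets borel" and x: "x \<in> op_dom C" "E B x = x"
    and c: "\<And>t. t \<in> B \<Longrightarrow> \<bar>t - r\<bar> \<le> c"
  shows "\<bar>inner x (shift r x)\<bar> \<le> c * (norm x)\<^sup>2"
proof -
  interpret finite_measure "scalar_measure E x"
    by (rule finite_measure_scalar_measure)
  have total: "measure (scalar_measure E x) UNIV = (norm x)\<^sup>2"
    by (simp add: measure_scalar_measure)
  have int: "integrable (scalar_measure E x) (\<lambda>t. t - r)"
    using integrable_id[OF x(1)] by simp
  have "inner x (complex_of_real r *\<^sub>C x) = r * (norm x)\<^sup>2"
    by (simp add: scaleC_of_real power2_norm_eq_inner)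
  then have "inner x (shift r x) = (\<integral>t. t - r \<partial>scalar_measure E x)"
    using integrable_id[OF x(1)] C_form[OF x(1)]
    by (simp add: shift_def inner_diff_right total mult.commute)
  then have "\<bar>inner x (shift r x)\<bar> \<le> (\<integral>t. norm (t - r) \<partial>scalar_measure E x)"
    using integral_norm_bound[of "scalar_measure E x" "\<lambda>t. t - r"] by simp
  also have "\<dots> \<le> (\<integral>t. c \<partial>scalar_measure E x)"
  proof (rule integral_mono_AE)
    show "AE t in scalar_measure E x. norm (t - r) \<le> c"
      using AE_scalar_measure_E[OF B, of x] unfolding x(2) by eventually_elim (use c in auto)
  qed (use int in auto)
  finally show ?thesis
    by (simp add: total mult.commute)
qed

text \<open>
  A symmetric operator whose quadratic form is bounded by \<open>c\<close> has norm at most \<open>c\<close>: polarize at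
  \<open>v\<close> and the multiple of \<open>(C - r) v\<close> that has the norm of \<open>v\<close>.
\<close>

lemma norm_shift_E_le:
  assumes B: "B \<in> sets borel" "bounded B" and c: "\<And>t. t \<in> B \<Longrightarrow> \<bar>t - r\<bar> \<le> c"
  shows "norm (shift r (E B x)) \<le> c * norm (E B x)"
proof (cases "E B x = 0 \<or> shift r (E B x) = 0")
  case True
  have "shift r 0 = 0"
    using C_scaleC[of "E B x" 0] E_bounded_in_dom[OF B] by (simp add: shift_def)
  \<comment> \<open>The bound \<open>c\<close> can be negative only for empty \<open>B\<close>, and
    then \<open>E B x = 0\<close> makes the right side vanish.\<close>
  moreover have "B = {} \<or> c \<ge> 0"
    using c by (meson abs_ge_zero all_not_in_conv order_trans)
  ultimately show ?thesis
    using True by auto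
next
  case False
  define v where "v = E B x"
  define s where "s = norm v / norm (shift r v)"
  define w where "w = s *\<^sub>R shift r v"
  have Ev: "E B v = v" and dv: "v \<in> op_dom C"
    using B by (simp_all add: v_def E_idem E_bounded_in_dom)
  have Ew: "E B w = w"
    using E_shift_commute[OF B(1) dv] Ev by (simp add: w_def blinfun.scaleR_right)
  then have dw: "w \<in> op_dom C"
    using E_bounded_in_dom[OF B] by metis
  have nz: "norm v > 0" "norm (shift r v) > 0"
    using False by (simp_all add: v_def)
  have nw: "norm w = norm v"
    using nz by (simp add: w_def s_def)
  have iw: "inner w (shift r v) = norm v * norm (shift r v)"
    using nz by (simp add: w_def s_def power2_norm_eq_inner[symmetric] power2_eq_square)
  have bound: "\<bar>inner u (shift r u)\<bar> \<le> c * (norm u)\<^sup>2" if "u \<in> op_dom C" "E B u = u" for u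
    by (rule shift_form_bound[OF B(1) that c])
  have p: "\<bar>inner (v + w) (shift r (v + w))\<bar> \<le> c * (norm (v + w))\<^sup>2"
    using Ev Ew C_add[OF dv dw] by (intro bound) (simp_all add: blinfun.add_right)
  have m: "\<bar>inner (v - w) (shift r (v - w))\<bar> \<le> c * (norm (v - w))\<^sup>2"
    using Ev Ew C_diff[OF dv dw] by (intro bound) (simp_all add: blinfun.diff_right)
  have sym: "inner v (shift r w) = inner w (shift r v)"
    using shift_symmetric[OF dw dv] by (simp add: inner_commute)
  have "4 * inner w (shift r v) =
      inner (v + w) (shift r (v + w)) - inner (v - w) (shift r (v - w))"
    by (simp add: shift_add shift_diff dv dw inner_add_left inner_add_right inner_diff_left
        inner_diff_right sym)
  also have "\<dots> \<le> c * (norm (v + w))\<^sup>2 + c * (norm (v - w))\<^sup>2"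
    using p m by linarith
  also have "\<dots> = 2 * c * ((norm v)\<^sup>2 + (norm w)\<^sup>2)"
    by (simp add: power2_norm_eq_inner inner_add_left inner_add_right inner_diff_left
        inner_diff_right inner_commute algebra_simps)
  finally have "norm v * norm (shift r v) \<le> norm v * (c * norm v)"
    by (simp add: nw iw power2_eq_square mult_ac)
  then show ?thesis
    using nz(1) by (simp add: v_def)
qed

text \<open>On the range of the projection of a ball of radius \<open>e\<close> around
  \<open>t\<close>, \<open>C - t\<close> shrinks vectors by the factor \<open>e\<close>. A bounded
  inverse \<open>R\<close> with \<open>norm R * e < 1\<close> then leaves only the zero
  vector.\<close>

lemma E_zero_near_resolvent_point:
  assumes "t \<notin> real_spec C"
  obtains U where "open U" "t \<in> U" "\<And>x. E U x = 0"
proof -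
  define R where "R = resolvent C (complex_of_real t)"
  have t: "complex_of_real t \<in> resolvent_set C"
    using assms by (simp add: real_spec_def spec_def)
  define e where "e = 1 / (norm R + 1)"
  have e: "e > 0"
    by (simp add: e_def add_nonneg_pos)
  have "norm R * e < 1"
    by (simp add: e_def add_nonneg_pos)
  have "E (ball t e) x = 0" for x
  proof (rule ccontr)
    define v where "v = E (ball t e) x"
    assume "E (ball t e) x \<noteq> 0"
    then have "norm v > 0" by (simp add: v_def)
    have "norm (shift t v) \<le> e * norm v"
      unfolding v_def by (rule norm_shift_E_le) (auto simp: dist_real_def)
    have "v = blinfun_apply R (shift t v)"
      unfolding R_def shift_def
      by (rule resolvent_eqI[OF linear_operator_C t C_graph, symmetric])
        (simp add: v_def E_bounded_in_dom)
    then have "norm v \<le> norm R * norm (shift t v)"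
      by (metis norm_blinfun)
    also have "\<dots> \<le> norm R * (e * norm v)"
      by (intro mult_left_mono) (fact, simp)
    also have "\<dots> = (norm R * e) * norm v"
      by simp
    also have "\<dots> < 1 * norm v"
      by (rule mult_strict_right_mono) fact+
    finally show False by simp
  qed
  with e show thesis
    using that[of "ball t e"] by simp
qed

text \<open>The local statement gives an open cover of the complement of the spectrum. Countable
  additivity needs a countable cover, which Lindelof supplies.\<close>

lemma E_disjoint_spec:
  assumes "B \<in> sets borel" "B \<inter> real_spec C = {}"
  shows "E B x = 0"
proof -
  let ?\<F> = "{U. open U \<and> (\<forall>x. E U x = 0)}"
  obtain \<U> where \<U>: "\<U> \<subseteq> ?\<F>" "countable \<U>" "\<Union>\<U> = \<Union>?\<F>"
    using Lindelof[of ?\<F>] by auto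
  have "B \<subseteq> \<Union>?\<F>"
  proof
    fix t assume "t \<in> B"
    then have "t \<notin> real_spec C" using assms(2) by blast
    then obtain U where "open U" "t \<in> U" "\<And>x. E U x = 0"
      using E_zero_near_resolvent_point by metis
    then show "t \<in> \<Union>?\<F>"
      by (intro UnionI[of U]) simp_all
  qed
  then show ?thesis
    using \<U>(1) by (intro E_null_Union[OF \<U>(2) _ _ assms(1)]) (auto simp: \<U>(3))
qed

end

section \<open>The strong operator topology\<close>

text \<open>The topology is pulled back along \<open>blinfun_apply\<close> from the product
  topology, where convergence is componentwise.\<close>

lemma limitin_strong_operator_topology:
  "limitin strong_operator_topology f l F \<longleftrightarrow>
    (\<forall>x. ((\<lambda>p. blinfun_apply (f p) x) \<longlongrightarrow> blinfun_apply l x) F)"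
proof -
  have "limitin strong_operator_topology f l F \<longleftrightarrow>
      limitin euclidean (\<lambda>p. blinfun_apply (f p)) (blinfun_apply l) F"
  proof
    assume L: "limitin strong_operator_topology f l F"
    have "eventually (\<lambda>p. blinfun_apply (f p) \<in> V) F" if "open V" "blinfun_apply l \<in> V" for V
    proof -
      have "openin strong_operator_topology (blinfun_apply -` V)"
        using that(1) by (auto simp: strong_operator_topology_def openin_pullback_topology)
      with L that(2) show ?thesis
        by (auto simp: limitin_def)
    qed
    then show "limitin euclidean (\<lambda>p. blinfun_apply (f p)) (blinfun_apply l) F"
      by (simp add: limitin_def)
  qed (auto simp: strong_operator_topology_def limitin_def openin_pullback_topology
      topspace_pullback_topology)
  also have "\<dots> \<longleftrightarrow> (\<forall>x. ((\<lambda>p. blinfun_apply (f p) x) \<longlongrightarrow> blinfun_apply l x) F)"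
    unfolding euclidean_product_topology[symmetric] limitin_componentwise by simp
  finally show ?thesis .
qed

text \<open>Passing to the subspace topology adds two side conditions: the limit, and eventually the
  approximants, must be complex-linear.\<close>

lemma limitin_sot:
  "limitin sot f l F \<longleftrightarrow> l \<in> bounded_ops \<and> eventually (\<lambda>p. f p \<in> bounded_ops) F \<and>
    (\<forall>x. ((\<lambda>p. blinfun_apply (f p) x) \<longlongrightarrow> blinfun_apply l x) F)"
  by (simp add: sot_def limitin_subtopology limitin_strong_operator_topology)


section \<open>Riemann--Stieltjes sums\<close>

lemma tagged_partition_mono:
  assumes "(n, m, z) \<in> tagged_partitions S a b" "i \<le> j" "j \<le> n"
  shows "m i \<le> m j"
  using assms(2,3)
proof (induction j rule: dec_induct)
  case (step j)
  then have "m j < m (Suc j)"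
    using assms(1) by (force simp: tagged_partitions_def)
  with step show ?case by simp
qed simp

lemma tagged_partition_interval:
  assumes "(n, m, z) \<in> tagged_partitions S a b" "k \<in> {1..n}"
  shows "a \<le> m (k - 1)" "m (k - 1) < m k" "m k \<le> b"
  using assms tagged_partition_mono[OF assms(1), of 0 "k - 1"]
    tagged_partition_mono[OF assms(1), of k n]
  by (auto simp: tagged_partitions_def)

lemma tagged_partition_disjoint:
  assumes P: "(n, m, z) \<in> tagged_partitions S a b" and "j \<in> {1..n}" "k \<in> {1..n}" "j \<noteq> k"
  shows "{m (j - 1)..<m j} \<inter> {m (k - 1)..<m k} = {}"
proof -
  have "m j \<le> m (k - 1) \<or> m k \<le> m (j - 1)"
    using assms(2-4) tagged_partition_mono[OF P, of j "k - 1"]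
      tagged_partition_mono[OF P, of k "j - 1"]
    by (cases "j < k") auto
  then show ?thesis by auto
qed

lemma tagged_partition_tag:
  assumes "(n, m, z) \<in> tagged_partitions S a b" "k \<in> {1..n}" "{m (k - 1)..<m k} \<inter> S \<noteq> {}"
  shows "z k \<in> S" "m (k - 1) \<le> z k" "z k < m k"
  using assms by (auto simp: tagged_partitions_def)

lemma stieltjes_sum_cong:
  assumes P: "p \<in> tagged_partitions S a b"
    and eq: "\<And>s t r. a \<le> s \<Longrightarrow> t \<le> b \<Longrightarrow> s \<le> r \<Longrightarrow> r < t \<Longrightarrow> r \<in> S \<Longrightarrow> h {s..<t} r = g {s..<t} r"
  shows "stieltjes_sum S h p = stieltjes_sum S g p"
proof -
  obtain n m z where p: "p = (n, m, z)" by (rule prod_cases3)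
  show ?thesis
    unfolding p stieltjes_sum_def prod.case
  proof (rule sum.cong[OF refl])
    fix k assume "k \<in> {k. k \<in> {1..n} \<and> {m (k - 1)..<m k} \<inter> S \<noteq> {}}"
    then have k: "k \<in> {1..n}" "{m (k - 1)..<m k} \<inter> S \<noteq> {}" by auto
    show "h {m (k - 1)..<m k} (z k) = g {m (k - 1)..<m k} (z k)"
      using tagged_partition_tag[OF P[unfolded p] k] tagged_partition_interval[OF P[unfolded p] k(1)]
      by (intro eq)
  qed
qed

lemma stieltjes_sum_add:
  "stieltjes_sum S (\<lambda>\<delta> r. h \<delta> r + g \<delta> r) p = stieltjes_sum S h p + stieltjes_sum S g p"
  by (cases p) (simp add: stieltjes_sum_def sum.distrib)

lemma stieltjes_sum_diff:
  fixes h g :: "real set \<Rightarrow> real \<Rightarrow> 'c::ab_group_add"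
  shows "stieltjes_sum S (\<lambda>\<delta> r. h \<delta> r - g \<delta> r) p = stieltjes_sum S h p - stieltjes_sum S g p"
  by (cases p) (simp add: stieltjes_sum_def sum_subtractf)

lemma blinfun_apply_stieltjes_sum:
  "blinfun_apply (stieltjes_sum S h p) x = stieltjes_sum S (\<lambda>\<delta> r. blinfun_apply (h \<delta> r) x) p"
  by (cases p) (simp add: stieltjes_sum_def blinfun.sum_left)

lemma stieltjes_sum_blinfun_apply:
  "stieltjes_sum S (\<lambda>\<delta> r. blinfun_apply T (h \<delta> r)) p = blinfun_apply T (stieltjes_sum S h p)"
  by (cases p) (simp add: stieltjes_sum_def blinfun.sum_right)

lemma stieltjes_sum_in_bounded_ops:
  assumes "p \<in> tagged_partitions S a b"
    and "\<And>s t r. r \<in> S \<Longrightarrow> h {s..<t} r \<in> bounded_ops"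
  shows "stieltjes_sum S h p \<in> bounded_ops"
proof -
  obtain n m z where p: "p = (n, m, z)" by (rule prod_cases3)
  show ?thesis
    unfolding p stieltjes_sum_def prod.case
    using tagged_partition_tag(1)[OF assms(1)[unfolded p]] by (intro bounded_ops_sum assms(2)) blast
qed

lemma stieltjes_sum_graph:
  assumes T: "linear_operator T" and "p \<in> tagged_partitions S a b"
    and "\<And>s t r. r \<in> S \<Longrightarrow> (h {s..<t} r, g {s..<t} r) \<in> T"
  shows "(stieltjes_sum S h p, stieltjes_sum S g p) \<in> T"
proof -
  obtain n m z where p: "p = (n, m, z)" by (rule prod_cases3)
  show ?thesis
    unfolding p stieltjes_sum_def prod.case
    using tagged_partition_tag(1)[OF assms(2)[unfolded p]]
    by (intro linear_operator_sum[OF T] assms(3)) blast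
qed

text \<open>The infimum is over a directed family: for two mesh bounds, \<open>min c d\<close> lies
  below both.\<close>

lemma eventually_mesh_to_zero:
  "eventually P (mesh_to_zero S a b) \<longleftrightarrow>
    (\<exists>d>0. \<forall>n m z. (n, m, z) \<in> tagged_partitions S a b \<longrightarrow>
      (\<forall>k\<in>{1..n}. m k - m (k - 1) < d) \<longrightarrow> P (n, m, z))"
proof -
  let ?F = "\<lambda>d. {(n, m, z). (n, m, z) \<in> tagged_partitions S a b \<and> (\<forall>k\<in>{1..n}. m k - m (k - 1) < d)}"
  have "\<exists>x\<in>{0<..}. principal (?F x) \<le> inf (principal (?F c)) (principal (?F d))"
    if "c \<in> {0<..}" "d \<in> {0<..}" for c d :: real
    using that by (intro bexI[of _ "min c d"]) (auto simp: min_def)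
  then have "eventually P (mesh_to_zero S a b) \<longleftrightarrow> (\<exists>d\<in>{0<..}. eventually P (principal (?F d)))"
    unfolding mesh_to_zero_def by (intro eventually_INF_base) auto
  also have "\<dots> \<longleftrightarrow> (\<exists>d>0. \<forall>n m z. (n, m, z) \<in> tagged_partitions S a b \<longrightarrow>
      (\<forall>k\<in>{1..n}. m k - m (k - 1) < d) \<longrightarrow> P (n, m, z))"
    by (simp add: eventually_principal Ball_def Bex_def imp_conjL)
  finally show ?thesis .
qed

lemma eventually_tagged_partition: "\<forall>\<^sub>F p in mesh_to_zero S a b. p \<in> tagged_partitions S a b"
  unfolding eventually_mesh_to_zero by (intro exI[of _ 1]) simp

text \<open>Equal subdivisions have arbitrarily small mesh. Without this, limits would not be unique
  and a closed graph would not retain them.\<close>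

lemma mesh_to_zero_nontrivial:
  assumes "a < b"
  shows "mesh_to_zero S a b \<noteq> bot"
proof
  assume "mesh_to_zero S a b = bot"
  then have "eventually (\<lambda>p. False) (mesh_to_zero S a b)" by simp
  then obtain d where d: "d > 0"
    and no: "\<And>n m z. (n, m, z) \<in> tagged_partitions S a b \<Longrightarrow> \<not> (\<forall>k\<in>{1..n}. m k - m (k - 1) < d)"
    unfolding eventually_mesh_to_zero by blast
  obtain n where n: "(b - a) / d < real n"
    using reals_Archimedean2 by blast
  then have "n > 0"
    using assms d by (intro gr0I) (simp add: divide_simps)
  define m where "m k = a + real k * ((b - a) / real n)" for k
  define z where "z k = (SOME t. t \<in> {m (k - 1)..<m k} \<inter> S)" for k
  have gap: "m k - m (k - 1) = (b - a) / real n" if "k \<in> {1..n}" for k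
    using that by (simp add: m_def of_nat_diff algebra_simps diff_divide_distrib)
  have pos: "(b - a) / real n > 0"
    using assms \<open>n > 0\<close> by simp
  have P: "(n, m, z) \<in> tagged_partitions S a b"
    unfolding tagged_partitions_def
  proof (intro CollectI, unfold prod.case, intro conjI ballI impI)
    show "m 0 = a" "m n = b"
      using \<open>n > 0\<close> by (simp_all add: m_def)
    fix k assume k: "k \<in> {1..n}"
    show "m (k - 1) < m k"
      using gap[OF k] pos by linarith
    assume "{m (k - 1)..<m k} \<inter> S \<noteq> {}"
    then obtain t where "t \<in> {m (k - 1)..<m k} \<inter> S" by blast
    then show "z k \<in> {m (k - 1)..<m k} \<inter> S"
      unfolding z_def by (rule someI)
  qed
  have "(b - a) / real n < d"
    using n d \<open>n > 0\<close> by (simp add: divide_simps mult.commute)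
  then have "\<forall>k\<in>{1..n}. m k - m (k - 1) < d"
    using gap by simp
  with no[OF P] show False ..
qed

text \<open>The form in which both error estimates arrive: the squared norm is linear in the mesh,
  with a constant depending on the window.\<close>

lemma tendsto_zero_mesh_to_zero:
  fixes f :: "tagged_partition \<Rightarrow> 'c::real_normed_vector"
  assumes "\<And>n m z d. (n, m, z) \<in> tagged_partitions S a b \<Longrightarrow> d > 0 \<Longrightarrow>
      (\<And>k. k \<in> {1..n} \<Longrightarrow> m k - m (k - 1) < d) \<Longrightarrow> (norm (f (n, m, z)))\<^sup>2 \<le> K * d"
  shows "(f \<longlongrightarrow> 0) (mesh_to_zero S a b)"
proof (rule tendstoI)
  fix e :: real assume "e > 0"
  \<comment> \<open>The constant \<open>K\<close> has no prescribed sign;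
    \<open>\<bar>K\<bar> + 1\<close> is positive and makes \<open>K * d < e\<^sup>2\<close>
    strict.\<close>
  define d where "d = e\<^sup>2 / (\<bar>K\<bar> + 1)"
  have "d > 0"
    using \<open>e > 0\<close> by (simp add: d_def add_nonneg_pos)
  have "K * d \<le> \<bar>K\<bar> * d"
    using \<open>d > 0\<close> by (intro mult_right_mono) auto
  also have "\<dots> < (\<bar>K\<bar> + 1) * d"
    using \<open>d > 0\<close> by (simp add: algebra_simps)
  also have "\<dots> = e\<^sup>2"
    by (simp add: d_def add_nonneg_pos)
  finally have "K * d < e\<^sup>2" .
  show "\<forall>\<^sub>F p in mesh_to_zero S a b. dist (f p) 0 < e"
    unfolding eventually_mesh_to_zero
  proof (intro exI[of _ d] conjI allI impI)
    fix n m z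
    assume "(n, m, z) \<in> tagged_partitions S a b" "\<forall>k\<in>{1..n}. m k - m (k - 1) < d"
    then have "(norm (f (n, m, z)))\<^sup>2 \<le> K * d"
      using \<open>d > 0\<close> by (intro assms) auto
    then have "(norm (f (n, m, z)))\<^sup>2 < e\<^sup>2"
      using \<open>K * d < e\<^sup>2\<close> by linarith
    then show "dist (f (n, m, z)) 0 < e"
      using \<open>e > 0\<close> by (simp add: power2_less_imp_less)
  qed fact
qed

text \<open>One factor of each squared length is bounded by the mesh, and the remaining lengths
  telescope.\<close>

lemma tagged_partition_sum_squares:
  assumes P: "(n, m, z) \<in> tagged_partitions S a b" and "I \<subseteq> {1..n}"
    and d: "\<And>k. k \<in> {1..n} \<Longrightarrow> m k - m (k - 1) < d"
  shows "(\<Sum>k\<in>I. (m k - m (k - 1))\<^sup>2) \<le> d * (b - a)"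
proof -
  have "(\<Sum>k\<in>I. (m k - m (k - 1))\<^sup>2) \<le> (\<Sum>k\<in>{1..n}. (m k - m (k - 1))\<^sup>2)"
    using assms(2) by (intro sum_mono2) auto
  also have "\<dots> \<le> (\<Sum>k\<in>{1..n}. d * (m k - m (k - 1)))"
  proof (rule sum_mono)
    fix k assume k: "k \<in> {1..n}"
    show "(m k - m (k - 1))\<^sup>2 \<le> d * (m k - m (k - 1))"
      unfolding power2_eq_square using d[OF k] tagged_partition_interval(2)[OF P k]
      by (intro mult_right_mono) auto
  qed
  also have "\<dots> = d * (\<Sum>k\<in>{Suc 0..n}. m k - m (k - 1))"
    by (simp add: sum_distrib_left)
  also have "(\<Sum>k\<in>{Suc 0..n}. m k - m (k - 1)) = m n - m 0"
    by (rule sum_telescope'') simp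
  also have "m n - m 0 = b - a"
    using P by (simp add: tagged_partitions_def)
  finally show ?thesis .
qed

lemma has_stieltjes_integral_sot_unique:
  fixes h :: "real set \<Rightarrow> real \<Rightarrow> ('a::complex_hilbert_space \<Rightarrow>\<^sub>L 'b::complex_hilbert_space)"
  assumes "has_stieltjes_integral sot S h I" "has_stieltjes_integral sot S h I'"
  shows "I = I'"
proof (rule blinfun_eqI)
  fix x
  obtain J where J: "\<And>a b. a < b \<Longrightarrow> limitin sot (stieltjes_sum S h) (J a b) (mesh_to_zero S a b)"
    and I: "limitin sot (\<lambda>(a, b). J a b) I (at_bot \<times>\<^sub>F at_top)"
    using assms(1) unfolding has_stieltjes_integral_def has_stieltjes_integral_on_def by blast
  obtain J' where J': "\<And>a b. a < b \<Longrightarrow> limitin sot (stieltjes_sum S h) (J' a b) (mesh_to_zero S a b)"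
    and I': "limitin sot (\<lambda>(a, b). J' a b) I' (at_bot \<times>\<^sub>F at_top)"
    using assms(2) unfolding has_stieltjes_integral_def has_stieltjes_integral_on_def by blast
  have eq: "blinfun_apply (J a b) x = blinfun_apply (J' a b) x" if "a < b" for a b
    using J[OF that] J'[OF that] tendsto_unique[OF mesh_to_zero_nontrivial[OF that]]
    unfolding limitin_sot by blast
  \<comment> \<open>The definition constrains the window integrals for \<open>a < b\<close> only;
    the condition \<open>a \<le> 0\<close>, \<open>b \<ge> 1\<close> holds eventually and implies
    it.\<close>
  have "\<forall>\<^sub>F (a, b) in at_bot \<times>\<^sub>F at_top. (a::real) \<le> 0 \<and> (b::real) \<ge> 1"
    by (rule eventually_prodI[OF eventually_le_at_bot eventually_ge_at_top, THEN eventually_mono]) auto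
  then have "\<forall>\<^sub>F p in at_bot \<times>\<^sub>F at_top.
      blinfun_apply (case p of (a, b) \<Rightarrow> J a b) x = blinfun_apply (case p of (a, b) \<Rightarrow> J' a b) x"
    by (rule eventually_mono) (auto intro: eq)
  then have "((\<lambda>p. blinfun_apply (case p of (a, b) \<Rightarrow> J' a b) x) \<longlongrightarrow> blinfun_apply I x)
      (at_bot \<times>\<^sub>F at_top)"
    using I unfolding limitin_sot by (blast intro: Lim_transform_eventually)
  then show "blinfun_apply I x = blinfun_apply I' x"
    using I' unfolding limitin_sot
    by (intro tendsto_unique[of "at_bot \<times>\<^sub>F at_top"]) (auto simp: prod_filter_eq_bot)
qed

section \<open>Sums of spectral projections and their error terms\<close>

context spectral_resolution
begin

abbreviation \<Sigma> :: "real set" where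
  "\<Sigma> \<equiv> real_spec C"

lemma E_partition:
  assumes P: "(n, m, z) \<in> tagged_partitions \<Sigma> a b"
  shows "E {a..<b} x = (\<Sum>k\<in>{1..n}. E {m (k - 1)..<m k} x)"
proof -
  have "E {m 0..<m j} x = (\<Sum>k\<in>{1..j}. E {m (k - 1)..<m k} x)" if "j \<le> n" for j
    using that
  proof (induction j)
    case (Suc j)
    have le: "m 0 \<le> m j" "m j \<le> m (Suc j)"
      using Suc by (auto intro: tagged_partition_mono[OF P])
    then have "E {m 0..<m (Suc j)} x = E ({m 0..<m j} \<union> {m j..<m (Suc j)}) x"
      by (simp add: ivl_disj_un)
    also have "\<dots> = E {m 0..<m j} x + E {m j..<m (Suc j)} x"
      by (rule E_Un) auto
    finally show ?case
      using Suc by simp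
  qed simp
  from this[of n] show ?thesis
    using P by (simp add: tagged_partitions_def)
qed

text \<open>The skipped intervals miss the spectrum, so \<open>E_disjoint_spec\<close> lets them be
  put back at no cost. The result is exact for every partition, not just in the limit.\<close>

lemma stieltjes_sum_E:
  assumes "p \<in> tagged_partitions \<Sigma> a b"
  shows "stieltjes_sum \<Sigma> (\<lambda>\<delta> r. E \<delta> x) p = E {a..<b} x"
proof -
  obtain n m z where p: "p = (n, m, z)" by (rule prod_cases3)
  have "stieltjes_sum \<Sigma> (\<lambda>\<delta> r. E \<delta> x) p = (\<Sum>k\<in>{1..n}. E {m (k - 1)..<m k} x)"
    unfolding p stieltjes_sum_def prod.case
    by (rule sum.mono_neutral_left) (auto intro!: E_disjoint_spec)
  then show ?thesis
    using E_partition assms by (simp add: p)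
qed

lemma norm_shift_tag_le:
  assumes "s \<le> r" "r < t"
  shows "norm (shift r (E {s..<t} x)) \<le> (t - s) * norm (E {s..<t} x)"
  by (rule norm_shift_E_le) (use assms in auto)

text \<open>
  The terms lie in the mutually orthogonal ranges of the \<open>E \<delta>\<close>, so the square of the norm of the sum
  is at most the sum of the \<open>\<bar>\<delta>\<bar>\<^sup>2 M\<^sup>2\<close>.
\<close>

lemma left_error_tendsto_zero:
  assumes w: "\<And>r. r \<in> \<Sigma> \<Longrightarrow> a \<le> r \<Longrightarrow> r < b \<Longrightarrow> norm (w r) \<le> M"
  shows "((\<lambda>p. stieltjes_sum \<Sigma> (\<lambda>\<delta> r. shift r (E \<delta> (w r))) p) \<longlongrightarrow> 0) (mesh_to_zero \<Sigma> a b)"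
proof (rule tendsto_zero_mesh_to_zero)
  fix n m z and d :: real
  assume P: "(n, m, z) \<in> tagged_partitions \<Sigma> a b" and d: "\<And>k. k \<in> {1..n} \<Longrightarrow> m k - m (k - 1) < d"
  define I where "I = {k \<in> {1..n}. {m (k - 1)..<m k} \<inter> \<Sigma> \<noteq> {}}"
  define f where "f k = shift (z k) (E {m (k - 1)..<m k} (w (z k)))" for k
  have I: "finite I" "I \<subseteq> {1..n}"
    by (auto simp: I_def)
  \<comment> \<open>Each term is fixed by its own projection because \<open>shift\<close> commutes
    with it. Orthogonality thus survives although both tag and vector change with
    \<open>k\<close>.\<close>
  have f_E: "f k = E {m (k - 1)..<m k} (f k)" for k
    by (simp add: f_def E_shift_commute E_bounded_in_dom E_idem)
  have "(norm (sum f I))\<^sup>2 = (\<Sum>k\<in>I. (norm (f k))\<^sup>2)"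
  proof (rule norm_sum_Pythagorean[OF I(1)], rule pairwiseI)
    fix j k assume "j \<in> I" "k \<in> I" "j \<noteq> k"
    then have "orthogonal (E {m (j - 1)..<m j} (f j)) (E {m (k - 1)..<m k} (f k))"
      using I(2) by (intro orthogonal_E_E tagged_partition_disjoint[OF P]) auto
    then show "orthogonal (f j) (f k)"
      using f_E by metis
  qed
  also have "\<dots> \<le> (\<Sum>k\<in>I. M\<^sup>2 * (m k - m (k - 1))\<^sup>2)"
  proof (rule sum_mono)
    fix k assume "k \<in> I"
    then have k: "k \<in> {1..n}" "{m (k - 1)..<m k} \<inter> \<Sigma> \<noteq> {}"
      by (auto simp: I_def)
    note tag = tagged_partition_tag[OF P k] and ivl = tagged_partition_interval[OF P k(1)]
    have "norm (f k) \<le> (m k - m (k - 1)) * norm (E {m (k - 1)..<m k} (w (z k)))"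
      unfolding f_def by (rule norm_shift_tag_le) fact+
    also have "\<dots> \<le> (m k - m (k - 1)) * M"
      using ivl tag by (intro mult_left_mono order_trans[OF norm_E_le w]) auto
    finally have "(norm (f k))\<^sup>2 \<le> ((m k - m (k - 1)) * M)\<^sup>2"
      by (intro power_mono) auto
    then show "(norm (f k))\<^sup>2 \<le> M\<^sup>2 * (m k - m (k - 1))\<^sup>2"
      by (simp add: power_mult_distrib mult.commute)
  qed
  also have "\<dots> = M\<^sup>2 * (\<Sum>k\<in>I. (m k - m (k - 1))\<^sup>2)"
    by (simp add: sum_distrib_left)
  also have "\<dots> \<le> M\<^sup>2 * (d * (b - a))"
    by (intro mult_left_mono tagged_partition_sum_squares[OF P I(2) d]) auto
  finally show "(norm (stieltjes_sum \<Sigma> (\<lambda>\<delta> r. shift r (E \<delta> (w r))) (n, m, z)))\<^sup>2 \<le> (M\<^sup>2 * (b - a)) * d"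
    by (simp add: stieltjes_sum_def f_def I_def mult_ac)
qed

text \<open>The operators \<open>G r\<close> act after the projections and destroy orthogonality of
  the terms. Cauchy--Schwarz separates the lengths from the norms of the
  \<open>E \<delta> x\<close>, which are still orthogonal and whose squares sum to at most
  \<open>(norm x)\<^sup>2\<close>.\<close>

lemma right_error_tendsto_zero:
  fixes G :: "real \<Rightarrow> ('a \<Rightarrow>\<^sub>L 'b::real_normed_vector)"
  assumes G: "\<And>r. r \<in> \<Sigma> \<Longrightarrow> a \<le> r \<Longrightarrow> r < b \<Longrightarrow> norm (G r) \<le> M"
  shows "((\<lambda>p. stieltjes_sum \<Sigma> (\<lambda>\<delta> r. G r (shift r (E \<delta> x))) p) \<longlongrightarrow> 0) (mesh_to_zero \<Sigma> a b)"
proof (rule tendsto_zero_mesh_to_zero)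
  fix n m z and d :: real
  assume P: "(n, m, z) \<in> tagged_partitions \<Sigma> a b" and d: "\<And>k. k \<in> {1..n} \<Longrightarrow> m k - m (k - 1) < d"
  define I where "I = {k \<in> {1..n}. {m (k - 1)..<m k} \<inter> \<Sigma> \<noteq> {}}"
  define \<delta> where "\<delta> k = {m (k - 1)..<m k}" for k
  define l where "l k = m k - m (k - 1)" for k
  have I: "finite I" "I \<subseteq> {1..n}"
    by (auto simp: I_def)
  have "norm (\<Sum>k\<in>I. G (z k) (shift (z k) (E (\<delta> k) x))) \<le> (\<Sum>k\<in>I. M * (l k * norm (E (\<delta> k) x)))"
  proof (rule sum_norm_le)
    fix k assume "k \<in> I"
    then have k: "k \<in> {1..n}" "{m (k - 1)..<m k} \<inter> \<Sigma> \<noteq> {}"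
      by (auto simp: I_def)
    note tag = tagged_partition_tag[OF P k] and ivl = tagged_partition_interval[OF P k(1)]
    have M: "norm (G (z k)) \<le> M"
      using tag ivl by (intro G) auto
    have "norm (G (z k) (shift (z k) (E (\<delta> k) x))) \<le> norm (G (z k)) * norm (shift (z k) (E (\<delta> k) x))"
      by (rule norm_blinfun)
    also have "\<dots> \<le> M * (l k * norm (E (\<delta> k) x))"
      unfolding l_def \<delta>_def using tag M order_trans[OF norm_ge_zero M]
      by (intro mult_mono norm_shift_tag_le) auto
    finally show "norm (G (z k) (shift (z k) (E (\<delta> k) x))) \<le> M * (l k * norm (E (\<delta> k) x))" .
  qed
  then have "(norm (\<Sum>k\<in>I. G (z k) (shift (z k) (E (\<delta> k) x))))\<^sup>2 \<le> (\<Sum>k\<in>I. M * (l k * norm (E (\<delta> k) x)))\<^sup>2"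
    by (intro power_mono) auto
  also have "\<dots> = M\<^sup>2 * (\<Sum>k\<in>I. l k * norm (E (\<delta> k) x))\<^sup>2"
    by (simp add: sum_distrib_left[symmetric] power_mult_distrib)
  also have "\<dots> \<le> M\<^sup>2 * ((\<Sum>k\<in>I. (l k)\<^sup>2) * (\<Sum>k\<in>I. (norm (E (\<delta> k) x))\<^sup>2))"
    by (intro mult_left_mono Cauchy_Schwarz_ineq_sum) auto
  also have "\<dots> \<le> M\<^sup>2 * ((d * (b - a)) * (norm x)\<^sup>2)"
  proof (intro mult_left_mono mult_mono)
    show "(\<Sum>k\<in>I. (l k)\<^sup>2) \<le> d * (b - a)"
      unfolding l_def by (rule tagged_partition_sum_squares[OF P I(2) d])
    \<comment> \<open>The sign is read off from the sum of squares that was just bounded.\<close>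
    then show "d * (b - a) \<ge> 0"
      by (rule order_trans[rotated]) (auto intro: sum_nonneg)
    have "(\<Sum>k\<in>I. (norm (E (\<delta> k) x))\<^sup>2) \<le> (\<Sum>k\<in>{1..n}. (norm (E (\<delta> k) x))\<^sup>2)"
      using I by (intro sum_mono2) auto
    also have "\<dots> = (norm (\<Sum>k\<in>{1..n}. E (\<delta> k) x))\<^sup>2"
      unfolding \<delta>_def
      by (intro norm_sum_Pythagorean[symmetric] pairwiseI orthogonal_E_E tagged_partition_disjoint[OF P])
        auto
    also have "\<dots> = (norm (E {a..<b} x))\<^sup>2"
      by (simp add: E_partition[OF P] \<delta>_def)
    also have "\<dots> \<le> (norm x)\<^sup>2"
      by (intro power_mono norm_E_le) auto
    finally show "(\<Sum>k\<in>I. (norm (E (\<delta> k) x))\<^sup>2) \<le> (norm x)\<^sup>2" .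
  qed (auto intro: sum_nonneg)
  finally show "(norm (stieltjes_sum \<Sigma> (\<lambda>\<delta> r. G r (shift r (E \<delta> x))) (n, m, z)))\<^sup>2
      \<le> (M\<^sup>2 * (b - a) * (norm x)\<^sup>2) * d"
    by (simp add: stieltjes_sum_def I_def \<delta>_def mult_ac)
qed

end

section \<open>The Sylvester equation\<close>

text \<open>\<open>T\<close> stands for \<open>A\<close> in the original equation and for
  \<open>adjoint_op A\<close> in the dual one, so that the latter is not derived from the former by
  taking adjoints. The bound on the resolvent may depend on the window.\<close>

locale sylvester = spectral_resolution C E
  for C :: "('k::complex_hilbert_space \<times> 'k) set" and E +
  fixes T :: "('h::complex_hilbert_space \<times> 'h) set"
  assumes linear_operator_T: "linear_operator T"
    and spec_disjoint: "\<And>r. r \<in> \<Sigma> \<Longrightarrow> complex_of_real r \<in> resolvent_set T"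
    and resolvent_bounded: "\<And>a b. \<exists>M. \<forall>r\<in>\<Sigma>. a \<le> r \<longrightarrow> r < b \<longrightarrow> norm (resolvent T (complex_of_real r)) \<le> M"
begin

abbreviation R :: "real \<Rightarrow> ('h \<Rightarrow>\<^sub>L 'h)" where
  "R r \<equiv> resolvent T (complex_of_real r)"

lemma R_in_bounded_ops: "r \<in> \<Sigma> \<Longrightarrow> R r \<in> bounded_ops"
  by (rule resolvent_in_bounded_ops[OF linear_operator_T spec_disjoint])

lemma R_graph: "r \<in> \<Sigma> \<Longrightarrow> (R r x, x + complex_of_real r *\<^sub>C R r x) \<in> T"
  by (rule resolvent_graph[OF linear_operator_T spec_disjoint])

lemma op_dom_T: "x \<in> op_dom T \<Longrightarrow> (x, op_app T x) \<in> T"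
  using op_dom_iff[OF linear_operator_T] by blast

lemma R_T:
  assumes "r \<in> \<Sigma>" "f \<in> op_dom T"
  shows "R r (op_app T f) = f + complex_of_real r *\<^sub>C R r f"
proof -
  have "R r (op_app T f - complex_of_real r *\<^sub>C f) = f"
    by (rule resolvent_eqI[OF linear_operator_T spec_disjoint op_dom_T]) fact+
  then show ?thesis
    by (simp add: blinfun.diff_right bounded_ops_scaleC[OF R_in_bounded_ops[OF assms(1)]] diff_eq_eq)
qed

text \<open>Supplies the hypothesis of \<open>left_error_tendsto_zero\<close>, with \<open>V\<close>
  the solution \<open>X\<close> in one direction and \<open>Y\<close> in the other.\<close>

lemma apply_resolvent_bound:
  fixes V :: "'h \<Rightarrow>\<^sub>L 'k"
  obtains M where "\<And>r. r \<in> \<Sigma> \<Longrightarrow> a \<le> r \<Longrightarrow> r < b \<Longrightarrow> norm (V (R r f)) \<le> M"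
proof -
  obtain M where M: "\<And>r. r \<in> \<Sigma> \<Longrightarrow> a \<le> r \<Longrightarrow> r < b \<Longrightarrow> norm (R r) \<le> M"
    using resolvent_bounded by blast
  have "norm (V (R r f)) \<le> norm V * (M * norm f)" if "r \<in> \<Sigma>" "a \<le> r" "r < b" for r
  proof -
    have "norm (V (R r f)) \<le> norm V * norm (R r f)"
      by (rule norm_blinfun)
    also have "\<dots> \<le> norm V * (norm (R r) * norm f)"
      by (intro mult_left_mono norm_blinfun) auto
    also have "\<dots> \<le> norm V * (M * norm f)"
      using M[OF that] by (intro mult_left_mono mult_right_mono) auto
    finally show ?thesis .
  qed
  with that show thesis .
qed

text \<open>The main term \<open>E \<delta> X x\<close> no longer depends on the tag and sums
  exactly to \<open>E {a..<b} (X x)\<close>; only the \<open>shift\<close> term has to be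
  estimated.\<close>

lemma left_integral_of_strong_solution:
  assumes Y: "Y \<in> bounded_ops" and X: "strong_solution T C Y X"
  shows "has_left_integral C E (\<lambda>r. Y o\<^sub>L R r) X"
  unfolding has_left_integral_def has_stieltjes_integral_def has_stieltjes_integral_on_def
proof (intro exI[of _ "\<lambda>a b. E {a..<b} o\<^sub>L X"] conjI allI impI)
  have X_ops: "X \<in> bounded_ops" and X_dom: "\<And>f. f \<in> op_dom T \<Longrightarrow> X f \<in> op_dom C"
    and X_eq: "\<And>f. f \<in> op_dom T \<Longrightarrow> X (op_app T f) - op_app C (X f) = Y f"
    using X by (auto simp: strong_solution_def)
  show "limitin sot (\<lambda>(a, b). E {a..<b} o\<^sub>L X) X (at_bot \<times>\<^sub>F at_top)"
    using X_ops tendsto_E_interval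
    by (simp add: limitin_sot case_prod_unfold bounded_ops_compose E_in_bounded_ops)
  fix a b :: real assume "a < b"
  let ?h = "\<lambda>\<delta> r. E \<delta> o\<^sub>L (Y o\<^sub>L R r)"
  show "limitin sot (stieltjes_sum \<Sigma> ?h) (E {a..<b} o\<^sub>L X) (mesh_to_zero \<Sigma> a b)"
    unfolding limitin_sot
  proof (intro conjI allI)
    show "E {a..<b} o\<^sub>L X \<in> bounded_ops"
      by (simp add: X_ops bounded_ops_compose E_in_bounded_ops)
    show "\<forall>\<^sub>F p in mesh_to_zero \<Sigma> a b. stieltjes_sum \<Sigma> ?h p \<in> bounded_ops"
      using eventually_tagged_partition
      by eventually_elim (erule stieltjes_sum_in_bounded_ops,
          simp add: Y bounded_ops_compose E_in_bounded_ops R_in_bounded_ops)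
    fix x
    obtain M where "\<And>r. r \<in> \<Sigma> \<Longrightarrow> a \<le> r \<Longrightarrow> r < b \<Longrightarrow> norm (X (R r x)) \<le> M"
      using apply_resolvent_bound by blast
    then have lim: "((\<lambda>p. E {a..<b} (X x) - stieltjes_sum \<Sigma> (\<lambda>\<delta> r. shift r (E \<delta> (X (R r x)))) p)
        \<longlongrightarrow> E {a..<b} (X x) - 0) (mesh_to_zero \<Sigma> a b)"
      by (intro tendsto_intros left_error_tendsto_zero)
    have eq: "E {s..<t} (Y (R r x)) = E {s..<t} (X x) - shift r (E {s..<t} (X (R r x)))"
      if "r \<in> \<Sigma>" for s t r
    proof -
      let ?f = "R r x"
      have f: "?f \<in> op_dom T" "op_app T ?f = x + complex_of_real r *\<^sub>C ?f"
        using R_graph[OF that, of x] by (auto simp: op_dom_def op_app_eqI[OF linear_operator_T])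
      have "Y ?f = X x - shift r (X ?f)"
        using X_eq[OF f(1)]
        by (simp add: f(2) shift_def blinfun.add_right bounded_ops_scaleC[OF X_ops] algebra_simps)
      then show ?thesis
        by (simp add: blinfun.diff_right E_shift_commute X_dom[OF f(1)])
    qed
    have "\<forall>\<^sub>F p in mesh_to_zero \<Sigma> a b.
        E {a..<b} (X x) - stieltjes_sum \<Sigma> (\<lambda>\<delta> r. shift r (E \<delta> (X (R r x)))) p =
        blinfun_apply (stieltjes_sum \<Sigma> ?h p) x"
      using eventually_tagged_partition
    proof eventually_elim
      case (elim p)
      have "blinfun_apply (stieltjes_sum \<Sigma> ?h p) x = stieltjes_sum \<Sigma> (\<lambda>\<delta> r. E \<delta> (Y (R r x))) p"
        by (simp add: blinfun_apply_stieltjes_sum)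
      also have "\<dots> = stieltjes_sum \<Sigma> (\<lambda>\<delta> r. E \<delta> (X x) - shift r (E \<delta> (X (R r x)))) p"
        by (rule stieltjes_sum_cong[OF elim]) (rule eq)
      finally show ?case
        by (simp add: stieltjes_sum_diff stieltjes_sum_E[OF elim])
    qed
    from Lim_transform_eventually[OF lim this]
    show "((\<lambda>p. blinfun_apply (stieltjes_sum \<Sigma> ?h p) x) \<longlongrightarrow> (E {a..<b} o\<^sub>L X) x) (mesh_to_zero \<Sigma> a b)"
      by simp
  qed
qed

text \<open>
  The sums \<open>s\<close> satisfy \<open>C s f = s T f - E [a, b) Y f\<close> up to an error that vanishes with the mesh, and
  the graph of \<open>C\<close> is closed.
\<close>

lemma strong_solution_of_left_integral:
  assumes Y: "Y \<in> bounded_ops" and X: "has_left_integral C E (\<lambda>r. Y o\<^sub>L R r) X"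
  shows "strong_solution T C Y X"
proof -
  let ?h = "\<lambda>\<delta> r. E \<delta> o\<^sub>L (Y o\<^sub>L R r)"
  obtain J where J: "\<And>a b. a < b \<Longrightarrow> limitin sot (stieltjes_sum \<Sigma> ?h) (J a b) (mesh_to_zero \<Sigma> a b)"
    and JX: "limitin sot (\<lambda>(a, b). J a b) X (at_bot \<times>\<^sub>F at_top)"
    using X unfolding has_left_integral_def has_stieltjes_integral_def has_stieltjes_integral_on_def
    by blast
  have graph_J: "(J a b f, J a b (op_app T f) - E {a..<b} (Y f)) \<in> C"
    if "a < b" and f: "f \<in> op_dom T" for a b f
  proof -
    obtain M where "\<And>r. r \<in> \<Sigma> \<Longrightarrow> a \<le> r \<Longrightarrow> r < b \<Longrightarrow> norm (Y (R r f)) \<le> M"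
      using apply_resolvent_bound by blast
    note error = left_error_tendsto_zero[OF this]
    note lim = J[OF that(1), unfolded limitin_sot, THEN conjunct2, THEN conjunct2, rule_format]
    let ?s = "\<lambda>p x. blinfun_apply (stieltjes_sum \<Sigma> ?h p) x"
    let ?e = "stieltjes_sum \<Sigma> (\<lambda>\<delta> r. shift r (E \<delta> (Y (R r f))))"
    \<comment> \<open>Adding the error \<open>?e p\<close> puts the pair exactly on the graph of
      \<open>C\<close> for each partition, and in the limit the correction disappears.\<close>
    have "((\<lambda>p. (?s p f, ?s p (op_app T f) - E {a..<b} (Y f) + ?e p)) \<longlongrightarrow>
        (J a b f, J a b (op_app T f) - E {a..<b} (Y f) + 0)) (mesh_to_zero \<Sigma> a b)"
      by (intro tendsto_intros lim error)
    moreover have "\<forall>\<^sub>F p in mesh_to_zero \<Sigma> a b. (?s p f, ?s p (op_app T f) - E {a..<b} (Y f) + ?e p) \<in> C"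
      using eventually_tagged_partition
    proof eventually_elim
      case (elim p)
      have "(stieltjes_sum \<Sigma> (\<lambda>\<delta> r. ?h \<delta> r f) p,
          stieltjes_sum \<Sigma> (\<lambda>\<delta> r. ?h \<delta> r (op_app T f) - E \<delta> (Y f) + shift r (E \<delta> (Y (R r f)))) p) \<in> C"
      proof (rule stieltjes_sum_graph[OF linear_operator_C elim])
        fix s t r assume r: "r \<in> \<Sigma>"
        note ops = E_in_bounded_ops[of "{s..<t}"]
        let ?v = "E {s..<t} (Y (R r f))"
        \<comment> \<open>Since \<open>R r (op_app T f) = f + r R r f\<close>, the first two terms
          leave \<open>r\<close> times \<open>?v\<close>, which is what \<open>shift r ?v\<close>
          lacks to be \<open>C ?v\<close>.\<close>
        have "?h {s..<t} r (op_app T f) - E {s..<t} (Y f) + shift r ?v = op_app C ?v"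
          by (simp add: R_T[OF r f] shift_def blinfun.add_right bounded_ops_scaleC[OF Y]
              bounded_ops_scaleC[OF ops])
        moreover have "(?v, op_app C ?v) \<in> C"
          by (intro C_graph E_bounded_in_dom) auto
        ultimately show "(?h {s..<t} r f,
            ?h {s..<t} r (op_app T f) - E {s..<t} (Y f) + shift r ?v) \<in> C"
          by simp
      qed
      then show ?case
        by (simp add: blinfun_apply_stieltjes_sum stieltjes_sum_add stieltjes_sum_diff
            stieltjes_sum_E[OF elim])
    qed
    ultimately show ?thesis
      using Lim_in_closed_set[OF closed_C _ mesh_to_zero_nontrivial[OF \<open>a < b\<close>]] by fastforce
  qed
  note lim = JX[unfolded limitin_sot, THEN conjunct2, THEN conjunct2, rule_format]
  have graph_X: "(X f, X (op_app T f) - Y f) \<in> C" if f: "f \<in> op_dom T" for f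
  proof -
    let ?J = "\<lambda>p x. blinfun_apply (case p of (a, b) \<Rightarrow> J a b) x"
    have "((\<lambda>p. (?J p f, ?J p (op_app T f) - (case p of (a, b) \<Rightarrow> E {a..<b} (Y f)))) \<longlongrightarrow>
        (X f, X (op_app T f) - Y f)) (at_bot \<times>\<^sub>F at_top)"
      by (intro tendsto_intros lim tendsto_E_interval)
    moreover have "\<forall>\<^sub>F (a, b) in at_bot \<times>\<^sub>F at_top. (a::real) \<le> 0 \<and> (b::real) \<ge> 1"
      by (rule eventually_prodI[OF eventually_le_at_bot eventually_ge_at_top, THEN eventually_mono]) auto
    then have "\<forall>\<^sub>F p in at_bot \<times>\<^sub>F at_top.
        (?J p f, ?J p (op_app T f) - (case p of (a, b) \<Rightarrow> E {a..<b} (Y f))) \<in> C"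
      by (rule eventually_mono) (use graph_J f in auto)
    ultimately show ?thesis
      by (intro Lim_in_closed_set[OF closed_C]) (auto simp: prod_filter_eq_bot)
  qed
  show ?thesis
    unfolding strong_solution_def
  proof (intro conjI ballI)
    show "X \<in> bounded_ops"
      using JX by (simp add: limitin_sot)
    show "X ` op_dom T \<subseteq> op_dom C"
      using graph_X by (auto simp: op_dom_def)
    show "X (op_app T f) - op_app C (X f) = Y f" if "f \<in> op_dom T" for f
      using op_app_eqI[OF linear_operator_C graph_X[OF that]] by simp
  qed
qed

text \<open>For \<open>g = E \<delta> x\<close> the equation gives
  \<open>R W g = R Z (C - r) g - Z g\<close>. The first term is the error and the second carries the
  sign, so the window integral is minus \<open>Z\<close> after \<open>E {a..<b}\<close>.\<close>

lemma right_integral_of_strong_solution: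
  assumes W: "W \<in> bounded_ops" and Z: "strong_solution C T W Z"
  shows "has_right_integral C E (\<lambda>r. R r o\<^sub>L W) (- Z)"
  unfolding has_right_integral_def has_stieltjes_integral_def has_stieltjes_integral_on_def
proof (intro exI[of _ "\<lambda>a b. - (Z o\<^sub>L E {a..<b})"] conjI allI impI)
  have Z_ops: "Z \<in> bounded_ops" and Z_dom: "\<And>g. g \<in> op_dom C \<Longrightarrow> Z g \<in> op_dom T"
    and Z_eq: "\<And>g. g \<in> op_dom C \<Longrightarrow> Z (op_app C g) - op_app T (Z g) = W g"
    using Z by (auto simp: strong_solution_def)
  have "((\<lambda>p. Z (case p of (a, b) \<Rightarrow> E {a..<b} x)) \<longlongrightarrow> Z x) (at_bot \<times>\<^sub>F at_top)" for x
    by (intro tendsto_intros tendsto_E_interval)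
  then show "limitin sot (\<lambda>(a, b). - (Z o\<^sub>L E {a..<b})) (- Z) (at_bot \<times>\<^sub>F at_top)"
    using Z_ops
    by (simp add: limitin_sot case_prod_unfold bounded_ops_uminus bounded_ops_compose
        E_in_bounded_ops blinfun.minus_left tendsto_minus)
  fix a b :: real assume "a < b"
  let ?h = "\<lambda>\<delta> r. (R r o\<^sub>L W) o\<^sub>L E \<delta>"
  show "limitin sot (stieltjes_sum \<Sigma> ?h) (- (Z o\<^sub>L E {a..<b})) (mesh_to_zero \<Sigma> a b)"
    unfolding limitin_sot
  proof (intro conjI allI)
    show "- (Z o\<^sub>L E {a..<b}) \<in> bounded_ops"
      by (simp add: Z_ops bounded_ops_uminus bounded_ops_compose E_in_bounded_ops)
    show "\<forall>\<^sub>F p in mesh_to_zero \<Sigma> a b. stieltjes_sum \<Sigma> ?h p \<in> bounded_ops"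
      using eventually_tagged_partition
      by eventually_elim (erule stieltjes_sum_in_bounded_ops,
          simp add: W bounded_ops_compose E_in_bounded_ops R_in_bounded_ops)
    fix x
    obtain M where M: "\<And>r. r \<in> \<Sigma> \<Longrightarrow> a \<le> r \<Longrightarrow> r < b \<Longrightarrow> norm (R r) \<le> M"
      using resolvent_bounded by blast
    have "norm (R r o\<^sub>L Z) \<le> M * norm Z" if "r \<in> \<Sigma>" "a \<le> r" "r < b" for r
      using M[OF that] by (intro order_trans[OF norm_blinfun_compose] mult_right_mono) auto
    from right_error_tendsto_zero[OF this, where x = x]
    have lim: "((\<lambda>p. stieltjes_sum \<Sigma> (\<lambda>\<delta> r. (R r o\<^sub>L Z) (shift r (E \<delta> x))) p - Z (E {a..<b} x))
        \<longlongrightarrow> 0 - Z (E {a..<b} x)) (mesh_to_zero \<Sigma> a b)"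
      by (intro tendsto_intros)
    have eq: "R r (W (E {s..<t} x)) = (R r o\<^sub>L Z) (shift r (E {s..<t} x)) - Z (E {s..<t} x)"
      if "r \<in> \<Sigma>" for s t r
    proof -
      let ?g = "E {s..<t} x"
      have g: "?g \<in> op_dom C"
        by (rule E_bounded_in_dom) auto
      have "R r (Z (op_app C ?g) - W ?g) = Z ?g + complex_of_real r *\<^sub>C R r (Z ?g)"
        using R_T[OF that Z_dom[OF g]] Z_eq[OF g] by (simp add: algebra_simps)
      then show ?thesis
        by (simp add: shift_def blinfun.diff_right bounded_ops_scaleC[OF Z_ops]
            bounded_ops_scaleC[OF R_in_bounded_ops[OF that]] algebra_simps)
    qed
    have "\<forall>\<^sub>F p in mesh_to_zero \<Sigma> a b.
        stieltjes_sum \<Sigma> (\<lambda>\<delta> r. (R r o\<^sub>L Z) (shift r (E \<delta> x))) p - Z (E {a..<b} x) =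
        blinfun_apply (stieltjes_sum \<Sigma> ?h p) x"
      using eventually_tagged_partition
    proof eventually_elim
      case (elim p)
      have "blinfun_apply (stieltjes_sum \<Sigma> ?h p) x = stieltjes_sum \<Sigma> (\<lambda>\<delta> r. R r (W (E \<delta> x))) p"
        by (simp add: blinfun_apply_stieltjes_sum)
      also have "\<dots> = stieltjes_sum \<Sigma> (\<lambda>\<delta> r. (R r o\<^sub>L Z) (shift r (E \<delta> x)) - Z (E \<delta> x)) p"
        by (rule stieltjes_sum_cong[OF elim]) (rule eq)
      finally show ?case
        by (simp add: stieltjes_sum_diff stieltjes_sum_blinfun_apply stieltjes_sum_E[OF elim])
    qed
    from Lim_transform_eventually[OF lim this]
    show "((\<lambda>p. blinfun_apply (stieltjes_sum \<Sigma> ?h p) x) \<longlongrightarrow> (- (Z o\<^sub>L E {a..<b})) x) (mesh_to_zero \<Sigma> a b)"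
      by (simp add: blinfun.minus_left)
  qed
qed

text \<open>Each term \<open>R r (W (E \<delta> g))\<close> lies in the domain of \<open>T\<close>,
  and \<open>T\<close> maps it to \<open>W (E \<delta> g)\<close> plus \<open>r\<close> times
  itself. Replacing that multiple of \<open>r\<close> by the term for \<open>C g\<close> costs a
  vanishing error, so closedness of \<open>T\<close> passes the relation to the limit.\<close>

lemma strong_solution_of_right_integral:
  assumes T: "closed T" and W: "W \<in> bounded_ops"
    and I: "has_right_integral C E (\<lambda>r. R r o\<^sub>L W) I"
  shows "strong_solution C T W (- I)"
proof -
  let ?h = "\<lambda>\<delta> r. (R r o\<^sub>L W) o\<^sub>L E \<delta>"
  obtain J where J: "\<And>a b. a < b \<Longrightarrow> limitin sot (stieltjes_sum \<Sigma> ?h) (J a b) (mesh_to_zero \<Sigma> a b)"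
    and JI: "limitin sot (\<lambda>(a, b). J a b) I (at_bot \<times>\<^sub>F at_top)"
    using I unfolding has_right_integral_def has_stieltjes_integral_def has_stieltjes_integral_on_def
    by blast
  have graph_J: "(J a b g, W (E {a..<b} g) + J a b (op_app C g)) \<in> T"
    if "a < b" and g: "g \<in> op_dom C" for a b g
  proof -
    obtain M where M: "\<And>r. r \<in> \<Sigma> \<Longrightarrow> a \<le> r \<Longrightarrow> r < b \<Longrightarrow> norm (R r) \<le> M"
      using resolvent_bounded by blast
    have "norm (R r o\<^sub>L W) \<le> M * norm W" if "r \<in> \<Sigma>" "a \<le> r" "r < b" for r
      using M[OF that] by (intro order_trans[OF norm_blinfun_compose] mult_right_mono) auto
    note error = right_error_tendsto_zero[OF this, where x = g]
    note lim = J[OF that(1), unfolded limitin_sot, THEN conjunct2, THEN conjunct2, rule_format]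
    let ?s = "\<lambda>p x. blinfun_apply (stieltjes_sum \<Sigma> ?h p) x"
    let ?e = "stieltjes_sum \<Sigma> (\<lambda>\<delta> r. (R r o\<^sub>L W) (shift r (E \<delta> g)))"
    have "((\<lambda>p. (?s p g, W (E {a..<b} g) + ?s p (op_app C g) - ?e p)) \<longlongrightarrow>
        (J a b g, W (E {a..<b} g) + J a b (op_app C g) - 0)) (mesh_to_zero \<Sigma> a b)"
      by (intro tendsto_intros lim error)
    moreover have "\<forall>\<^sub>F p in mesh_to_zero \<Sigma> a b. (?s p g, W (E {a..<b} g) + ?s p (op_app C g) - ?e p) \<in> T"
      using eventually_tagged_partition
    proof eventually_elim
      case (elim p)
      have "(stieltjes_sum \<Sigma> (\<lambda>\<delta> r. ?h \<delta> r g) p,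
          stieltjes_sum \<Sigma> (\<lambda>\<delta> r. W (E \<delta> g) + ?h \<delta> r (op_app C g) - (R r o\<^sub>L W) (shift r (E \<delta> g))) p) \<in> T"
      proof (rule stieltjes_sum_graph[OF linear_operator_T elim])
        fix s t r assume r: "r \<in> \<Sigma>"
        let ?u = "E {s..<t} g"
        have "W ?u + ?h {s..<t} r (op_app C g) - (R r o\<^sub>L W) (shift r ?u) =
            W ?u + complex_of_real r *\<^sub>C R r (W ?u)"
          by (simp add: E_C_commute g shift_def blinfun.diff_right bounded_ops_scaleC[OF W]
              bounded_ops_scaleC[OF R_in_bounded_ops[OF r]])
        then show "(?h {s..<t} r g,
            W ?u + ?h {s..<t} r (op_app C g) - (R r o\<^sub>L W) (shift r ?u)) \<in> T"
          using R_graph[OF r, of "W ?u"] by (simp only: blinfun_apply_blinfun_compose)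
      qed
      then show ?case
        by (simp add: blinfun_apply_stieltjes_sum stieltjes_sum_add stieltjes_sum_diff
            stieltjes_sum_blinfun_apply stieltjes_sum_E[OF elim])
    qed
    ultimately show ?thesis
      using Lim_in_closed_set[OF T _ mesh_to_zero_nontrivial[OF \<open>a < b\<close>]] by fastforce
  qed
  note lim = JI[unfolded limitin_sot, THEN conjunct2, THEN conjunct2, rule_format]
  have graph_I: "(I g, W g + I (op_app C g)) \<in> T" if g: "g \<in> op_dom C" for g
  proof -
    let ?J = "\<lambda>p x. blinfun_apply (case p of (a, b) \<Rightarrow> J a b) x"
    have "((\<lambda>p. (?J p g, W (case p of (a, b) \<Rightarrow> E {a..<b} g) + ?J p (op_app C g))) \<longlongrightarrow>
        (I g, W g + I (op_app C g))) (at_bot \<times>\<^sub>F at_top)"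
      by (intro tendsto_intros lim tendsto_E_interval)
    moreover have "\<forall>\<^sub>F (a, b) in at_bot \<times>\<^sub>F at_top. (a::real) \<le> 0 \<and> (b::real) \<ge> 1"
      by (rule eventually_prodI[OF eventually_le_at_bot eventually_ge_at_top, THEN eventually_mono]) auto
    then have "\<forall>\<^sub>F p in at_bot \<times>\<^sub>F at_top.
        (?J p g, W (case p of (a, b) \<Rightarrow> E {a..<b} g) + ?J p (op_app C g)) \<in> T"
      by (rule eventually_mono) (use graph_J g in auto)
    ultimately show ?thesis
      by (intro Lim_in_closed_set[OF T]) (auto simp: prod_filter_eq_bot)
  qed
  show ?thesis
    unfolding strong_solution_def
  proof (intro conjI ballI)
    show "- I \<in> bounded_ops"
      using JI by (simp add: limitin_sot bounded_ops_uminus)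
    have graph: "((- I) g, - (W g + I (op_app C g))) \<in> T" if "g \<in> op_dom C" for g
      using linear_operator_uminus[OF linear_operator_T graph_I[OF that]]
      by (simp add: blinfun.minus_left)
    show "(- I) ` op_dom C \<subseteq> op_dom T"
      using graph by (auto simp: op_dom_def)
    show "(- I) (op_app C g) - op_app T ((- I) g) = W g" if "g \<in> op_dom C" for g
      using op_app_eqI[OF linear_operator_T graph[OF that]] by (simp add: blinfun.minus_left)
  qed
qed

end

section \<open>Separated spectra and the main result\<close>

text \<open>Compactness forces a passage to the closure, whose points may lie outside the half-open
  window. Being arbitrarily close to the spectrum of \<open>C\<close>, they still stay away from the
  spectrum of \<open>A\<close>.\<close>

lemma compact_spec_subset_resolvent_set:
  assumes "set_dist (spec A) (spec C) > 0"
  shows "complex_of_real ` closure (real_spec C \<inter> {a..<b}) \<subseteq> resolvent_set A"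
    and "compact (complex_of_real ` closure (real_spec C \<inter> {a..<b}))"
proof -
  show "compact (complex_of_real ` closure (real_spec C \<inter> {a..<b}))"
  proof (rule compact_continuous_image)
    have "bounded (real_spec C \<inter> {a..<b})"
      by (rule bounded_subset[OF bounded_closed_interval[of a b]]) auto
    then show "compact (closure (real_spec C \<inter> {a..<b}))"
      by (simp add: compact_closure)
  qed (intro continuous_intros)
  \<comment> \<open>The distance may be infinite, so a finite positive number below it is
    chosen.\<close>
  obtain d where d: "0 < d" "ereal d < set_dist (spec A) (spec C)"
    using ereal_dense2[OF assms] by auto
  have far: "d < dist s t" if "s \<in> spec A" "t \<in> spec C" for s t
  proof -
    have "set_dist (spec A) (spec C) \<le> (INF t\<in>spec C. ereal (dist s t))"
      unfolding set_dist_def by (rule INF_lower) fact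
    also have "\<dots> \<le> ereal (dist s t)"
      by (rule INF_lower) fact
    finally have "ereal d < ereal (dist s t)"
      using d(2) less_le_trans by blast
    then show ?thesis by simp
  qed
  show "complex_of_real ` closure (real_spec C \<inter> {a..<b}) \<subseteq> resolvent_set A"
  proof (rule ccontr)
    assume "\<not> ?thesis"
    then obtain t where t: "t \<in> closure (real_spec C \<inter> {a..<b})" "complex_of_real t \<in> spec A"
      by (auto simp: spec_def)
    obtain r where "r \<in> real_spec C" "dist r t < d"
      using t(1) d(1) by (auto simp: closure_approachable)
    then show False
      using far[OF t(2), of "complex_of_real r"]
      by (simp add: real_spec_def dist_of_real dist_commute)
  qed
qed

theorem theorem2p14:
  fixes A :: "('h::complex_hilbert_space \<times> 'h) set"
    and C :: "('k::complex_hilbert_space \<times> 'k) set"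
    and E :: "real set \<Rightarrow> ('k \<Rightarrow>\<^sub>L 'k)"
    and Y :: "'h \<Rightarrow>\<^sub>L 'k"
  assumes "closed_operator A" and "densely_defined A"
    and "self_adjoint C" and "is_spectral_measure C E"
    and "Y \<in> bounded_ops"
    and "set_dist (spec A) (spec C) > 0"
  shows
    "(\<forall>X. strong_solution A C Y X \<longrightarrow>
        (\<forall>X'. strong_solution A C Y X' \<longrightarrow> X' = X) \<and>
        has_left_integral C E (\<lambda>\<mu>. Y o\<^sub>L resolvent A (complex_of_real \<mu>)) X) \<and>
     (\<forall>X. has_left_integral C E (\<lambda>\<mu>. Y o\<^sub>L resolvent A (complex_of_real \<mu>)) X \<longrightarrow>
        strong_solution A C Y X) \<and>
     (\<forall>Z. dual_strong_solution A C Y Z \<longrightarrow>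
        (\<forall>Z'. dual_strong_solution A C Y Z' \<longrightarrow> Z' = Z) \<and>
        (\<exists>I. has_right_integral C E
               (\<lambda>\<mu>. resolvent (adjoint_op A) (complex_of_real \<mu>) o\<^sub>L bounded_adjoint Y) I \<and>
             Z = - I)) \<and>
     (\<forall>I. has_right_integral C E
            (\<lambda>\<mu>. resolvent (adjoint_op A) (complex_of_real \<mu>) o\<^sub>L bounded_adjoint Y) I \<longrightarrow>
        dual_strong_solution A C Y (- I))"
proof -
  have A: "linear_operator A"
    using assms(1) by (simp add: closed_operator_def)
  have A': "linear_operator (adjoint_op A)"
    by (rule linear_operator_adjoint_op) fact
  have Y': "bounded_adjoint Y \<in> bounded_ops"
    by (rule bounded_adjoint_in_bounded_ops) fact
  interpret spectral_resolution C E
    by unfold_locales fact+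
  have res: "complex_of_real ` closure (real_spec C \<inter> {a..<b}) \<subseteq> resolvent_set A" for a b
    by (rule compact_spec_subset_resolvent_set) fact
  have cpt: "compact (complex_of_real ` closure (real_spec C \<inter> {a..<b}))" for a b
    by (rule compact_spec_subset_resolvent_set) fact
  have in_closure: "r \<in> closure (real_spec C \<inter> {a..<b})" if "r \<in> real_spec C" "a \<le> r" "r < b" for r a b
    using that closure_subset by fastforce
  \<comment> \<open>The points are real, hence equal to their conjugates, so the resolvent points of
    \<open>A\<close> carry over to the adjoint unchanged.\<close>
  have res': "complex_of_real ` closure (real_spec C \<inter> {a..<b}) \<subseteq> resolvent_set (adjoint_op A)" for a b
    using cnj_in_resolvent_set_adjoint[OF A assms(2)] res[of a b] by fastforce
  have syl: "sylvester C E T" if T: "linear_operator T"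
    and sub: "\<And>a b. complex_of_real ` closure (real_spec C \<inter> {a..<b}) \<subseteq> resolvent_set T"
  for T :: "('h \<times> 'h) set"
  proof
    show "linear_operator T" by fact
    show "complex_of_real r \<in> resolvent_set T" if "r \<in> real_spec C" for r
      \<comment> \<open>Any window containing \<open>r\<close> would do; the half-open one starting
        at \<open>r\<close> is the simplest.\<close>
      using sub[of r "r + 1"] in_closure[OF that, of r "r + 1"] by auto
    show "\<exists>M. \<forall>r\<in>real_spec C. a \<le> r \<longrightarrow> r < b \<longrightarrow> norm (resolvent T (complex_of_real r)) \<le> M" for a b
      using resolvent_bounded_on_compact[OF T cpt sub] in_closure by (metis imageI)
  qed
  interpret left: sylvester C E A
    by (rule syl[OF A res])
  interpret right: sylvester C E "adjoint_op A"
    by (rule syl[OF A' res'])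
  note left_forward = left.left_integral_of_strong_solution[OF assms(5)]
  note right_forward = right.right_integral_of_strong_solution[OF Y']
  show ?thesis
    unfolding dual_strong_solution_def
  proof (intro conjI allI impI)
    fix X assume X: "strong_solution A C Y X"
    show "has_left_integral C E (\<lambda>\<mu>. Y o\<^sub>L resolvent A (complex_of_real \<mu>)) X"
      by (rule left_forward[OF X])
    show "X' = X" if "strong_solution A C Y X'" for X'
      by (rule has_stieltjes_integral_sot_unique)
        (use left_forward[OF X] left_forward[OF that] in \<open>simp_all only: has_left_integral_def\<close>)
  next
    fix X assume "has_left_integral C E (\<lambda>\<mu>. Y o\<^sub>L resolvent A (complex_of_real \<mu>)) X"
    then show "strong_solution A C Y X"
      by (rule left.strong_solution_of_left_integral[OF assms(5)])
  next
    fix Z assume Z: "strong_solution C (adjoint_op A) (bounded_adjoint Y) Z"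
    show "\<exists>I. has_right_integral C E
        (\<lambda>\<mu>. resolvent (adjoint_op A) (complex_of_real \<mu>) o\<^sub>L bounded_adjoint Y) I \<and> Z = - I"
      using right_forward[OF Z] by (intro exI[of _ "- Z"]) simp
    show "Z' = Z" if "strong_solution C (adjoint_op A) (bounded_adjoint Y) Z'" for Z'
    proof -
      \<comment> \<open>Both sides are values of the same right integral, which carries the minus
        sign.\<close>
      have "- Z' = - Z"
        by (rule has_stieltjes_integral_sot_unique)
          (use right_forward[OF Z] right_forward[OF that] in \<open>simp_all only: has_right_integral_def\<close>)
      then show ?thesis by simp
    qed
  next
    fix I assume "has_right_integral C E
        (\<lambda>\<mu>. resolvent (adjoint_op A) (complex_of_real \<mu>) o\<^sub>L bounded_adjoint Y) I"
    then show "strong_solution C (adjoint_op A) (bounded_adjoint Y) (- I)"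
      by (rule right.strong_solution_of_right_integral[OF closed_adjoint_op Y'])
  qed
qed

end
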